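(* Let $\underline X$ be an $\mathfrak{Mo}$-scheme and let $X$ be its geometric realization, with structure sheaf $\mathcal O_X$ and stalks $\mathcal O_x$, $x\in X$. Then the (restriction) functor from abelian groups to sets $$H\mapsto\mathrm{Hom}(\mathrm{Spec}\,\mathbb F_1[H],X)=\underline X(\mathbb F_1[H])$$ is the disjoint union $$\underline X(\mathbb F_1[H])=\bigcup_{x\in X}\underline{X_x}(H),\qquad \underline{X_x}(H)=\mathrm{Hom}_{\mathfrak{Ab}}(\mathcal O_x^\times,H).$$
   Context: $\mathfrak{Ab}$ is the category of abelian groups. $\mathfrak{Mo}$ is the category of commutative (multiplicative) monoids $M$ with unit $1$ and absorbing element $0$; morphisms are multiplicative and preserve $1$ and $0$. $M^\times$ is the group of invertible elements; for an abelian group $H$, $\mathbb F_1[H]=H\cup\{0\}$. An ideal is a subset $I\ni0$ of $M$ with $IM\subset I$; it is prime if $1\notin I$ and $M\setminus I$ is multiplicatively closed. An $\mathfrak{Mo}$-functor is a covariant functor $\mathfrak{Mo}\to\mathfrak{Sets}$; $\mathfrak{spec}\,M$ denotes $N\mapsto\mathrm{Hom}_{\mathfrak{Mo}}(M,N)$. A subfunctor $\mathcal G\subset\mathcal F$ is open if for every $M$ and every $\varphi:\mathfrak{spec}\,M\to\mathcal F$ there is an ideal $I\subset M$ such that for all $N$ and $\rho\in\mathrm{Hom}(M,N)$: $\varphi(\rho)\in\mathcal G(N)\Leftrightarrow\rho(I)N=N$. Open subfunctors $\mathcal F_\alpha$ cover $\mathcal F$ if $\mathcal F(\mathbb F_1[H])=\bigcup_\alpha\mathcal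 F_\alpha(\mathbb F_1[H])$ for all abelian groups $H$. An $\mathfrak{Mo}$-scheme is an $\mathfrak{Mo}$-functor with an open cover by representable subfunctors. A geometric space is a topological space with a sheaf of monoids (objects of $\mathfrak{Mo}$); morphisms are pairs $(\varphi,\varphi^\sharp)$ with $\varphi$ continuous and $\varphi^\sharp$ local on stalks (a morphism $\rho:M_1\to M_2$ is local if $\rho^{-1}(M_2^\times)=M_1^\times$). $\mathrm{Spec}(M)$ is the set of prime ideals of $M$ with open sets $D(I)=\{\mathfrak p:I\not\subset\mathfrak p\}$ and the usual structure sheaf with stalks $(M\setminus\mathfrak p)^{-1}M$ and sections $M_f$ on $D(fM)$. A geometric $\mathfrak{Mo}$-scheme is a geometric space admitting an open cover by spaces isomorphic to some $\mathrm{Spec}(M)$. The geometric realization of an $\mathfrak{Mo}$-scheme $\underline X$ is the geometric $\mathfrak{Mo}$-scheme $X$, unique up to isomorphism, such that $\underline X(N)=\mathrm{Hom}(\mathrm{Spec}(N),X)$ naturally in $N$. *)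

theory Defs
  imports "HOL-Algebra.Coset" "HOL-Analysis.Abstract_Topology"
begin

section \<open>Monoids with an absorbing element\<close>

record 'a monoid0 = "'a monoid" +
  absorbing :: 'a

text \<open>The zero monoid (\<open>1 = 0\<close>) is allowed; it is the terminal object and the value of every
  sheaf on the empty set.\<close>

locale mo_monoid = comm_monoid M for M :: "('a, 'b) monoid0_scheme" (structure) +
  assumes absorbing_closed: "absorbing M \<in> carrier M"
    and absorbing_mult: "a \<in> carrier M \<Longrightarrow> absorbing M \<otimes> a = absorbing M"

text \<open>Maps between carriers are extensional throughout, so that two morphisms are equal as soon as
  they agree on the carrier and the Hom-sets below are the actual Hom-sets.\<close>

definition mo_hom :: "'a monoid0 \<Rightarrow> 'b monoid0 \<Rightarrow> ('a \<Rightarrow> 'b) set" where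
  "mo_hom M N = {\<rho> \<in> hom M N \<inter> extensional (carrier M).
     \<rho> \<one>\<^bsub>M\<^esub> = \<one>\<^bsub>N\<^esub> \<and> \<rho> (absorbing M) = absorbing N}"

definition ab_hom :: "'a monoid \<Rightarrow> 'b monoid \<Rightarrow> ('a \<Rightarrow> 'b) set" where
  "ab_hom A B = hom A B \<inter> extensional (carrier A)"

definition local_mo_hom :: "'a monoid0 \<Rightarrow> 'b monoid0 \<Rightarrow> ('a \<Rightarrow> 'b) \<Rightarrow> bool" where
  "local_mo_hom M N \<rho> \<longleftrightarrow> \<rho> \<in> mo_hom M N \<and> {a \<in> carrier M. \<rho> a \<in> Units N} = Units M"

definition mo_ideal :: "'a monoid0 \<Rightarrow> 'a set \<Rightarrow> bool" where
  "mo_ideal M I \<longleftrightarrow> I \<subseteq> carrier M \<and> absorbing M \<in> I \<and> I <#>\<^bsub>M\<^esub> carrier M \<subseteq> I"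

definition mo_prime :: "'a monoid0 \<Rightarrow> 'a set \<Rightarrow> bool" where
  "mo_prime M \<pp> \<longleftrightarrow> mo_ideal M \<pp> \<and> \<one>\<^bsub>M\<^esub> \<notin> \<pp> \<and>
     (\<forall>a \<in> carrier M - \<pp>. \<forall>b \<in> carrier M - \<pp>. a \<otimes>\<^bsub>M\<^esub> b \<in> carrier M - \<pp>)"

text \<open>\<open>F1 H\<close> is \<open>\<bbbF>\<^sub>1[H] = H \<union> {0}\<close>, with \<open>0\<close> rendered as \<^const>\<open>None\<close>.\<close>

definition F1 :: "'h monoid \<Rightarrow> 'h option monoid0" where
  "F1 H = \<lparr>carrier = insert None (Some ` carrier H),
     mult = (\<lambda>a b. case (a, b) of (Some g, Some h) \<Rightarrow> Some (g \<otimes>\<^bsub>H\<^esub> h) | _ \<Rightarrow> None),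
     one = Some \<one>\<^bsub>H\<^esub>, absorbing = None\<rparr>"

definition F1_map :: "'h monoid \<Rightarrow> ('h \<Rightarrow> 'k) \<Rightarrow> 'h option \<Rightarrow> 'k option" where
  "F1_map H h = restrict (map_option h) (carrier (F1 H))"

subsection \<open>Localization\<close>

text \<open>\<open>frac M S a f\<close> is the fraction \<open>a / f\<close> in \<open>S\<^sup>-\<^sup>1 M\<close>, as a class of pairs
  (numerator, denominator). Operations on such classes are defined as unions over representatives;
  on well-formed input all members of the union coincide.\<close>

definition frac :: "'a monoid0 \<Rightarrow> 'a set \<Rightarrow> 'a \<Rightarrow> 'a \<Rightarrow> ('a \<times> 'a) set" where
  "frac M S a f = {(b, g). b \<in> carrier M \<and> g \<in> S \<and>
     (\<exists>h \<in> S. h \<otimes>\<^bsub>M\<^esub> (g \<otimes>\<^bsub>M\<^esub> a) = h \<otimes>\<^bsub>M\<^esub> (f \<otimes>\<^bsub>M\<^esub> b))}"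

definition localization :: "'a monoid0 \<Rightarrow> 'a set \<Rightarrow> ('a \<times> 'a) set monoid0" where
  "localization M S = \<lparr>carrier = {frac M S a f | a f. a \<in> carrier M \<and> f \<in> S},
     mult = (\<lambda>c d. \<Union>(a, f) \<in> c. \<Union>(b, g) \<in> d. frac M S (a \<otimes>\<^bsub>M\<^esub> b) (f \<otimes>\<^bsub>M\<^esub> g)),
     one = frac M S \<one>\<^bsub>M\<^esub> \<one>\<^bsub>M\<^esub>, absorbing = frac M S (absorbing M) \<one>\<^bsub>M\<^esub>\<rparr>"

abbreviation loc_at :: "'a monoid0 \<Rightarrow> 'a set \<Rightarrow> ('a \<times> 'a) set monoid0" where
  "loc_at M \<pp> \<equiv> localization M (carrier M - \<pp>)"


section \<open>Set-valued functors\<close>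

text \<open>A concrete category: identities are \<open>\<lambda>x\<in>car C A. x\<close> and composition is
  \<^const>\<open>compose\<close>.\<close>

record ('o, 'e) concrete_cat =
  Ob :: "'o set"
  car :: "'o \<Rightarrow> 'e set"
  Hom :: "'o \<Rightarrow> 'o \<Rightarrow> ('e \<Rightarrow> 'e) set"

text \<open>The carriers of the objects lie in a fixed, arbitrary type, which plays the role of the
  set-theoretic universe.\<close>

definition Mo :: "('u monoid0, 'u) concrete_cat" where
  "Mo = \<lparr>Ob = {M. mo_monoid M}, car = carrier, Hom = mo_hom\<rparr>"

definition Ab :: "('h monoid, 'h) concrete_cat" where
  "Ab = \<lparr>Ob = {H. comm_group H}, car = carrier, Hom = ab_hom\<rparr>"

record ('o, 'e, 'x) set_fun =
  fobj :: "'o \<Rightarrow> 'x set"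
  fmap :: "'o \<Rightarrow> 'o \<Rightarrow> ('e \<Rightarrow> 'e) \<Rightarrow> 'x \<Rightarrow> 'x"

type_synonym ('u, 'x) mo_fun = "('u monoid0, 'u, 'x) set_fun"
type_synonym ('h, 'x) ab_fun = "('h monoid, 'h, 'x) set_fun"

definition set_functor :: "('o, 'e) concrete_cat \<Rightarrow> ('o, 'e, 'x) set_fun \<Rightarrow> bool" where
  "set_functor C F \<longleftrightarrow>
     (\<forall>A \<in> Ob C. \<forall>B \<in> Ob C. \<forall>f \<in> Hom C A B. fmap F A B f \<in> fobj F A \<rightarrow> fobj F B) \<and>
     (\<forall>A \<in> Ob C. \<forall>x \<in> fobj F A. fmap F A A (\<lambda>a\<in>car C A. a) x = x) \<and>
     (\<forall>A \<in> Ob C. \<forall>B \<in> Ob C. \<forall>D \<in> Ob C. \<forall>f \<in> Hom C A B. \<forall>g \<in> Hom C B D. \<forall>x \<in> fobj F A.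
        fmap F A D (compose (car C A) g f) x = fmap F B D g (fmap F A B f x))"

definition nat_trans :: "('o, 'e) concrete_cat \<Rightarrow> ('o, 'e, 'x) set_fun \<Rightarrow> ('o, 'e, 'y) set_fun
    \<Rightarrow> ('o \<Rightarrow> 'x \<Rightarrow> 'y) \<Rightarrow> bool" where
  "nat_trans C F G \<phi> \<longleftrightarrow>
     (\<forall>A \<in> Ob C. \<phi> A \<in> fobj F A \<rightarrow> fobj G A) \<and>
     (\<forall>A \<in> Ob C. \<forall>B \<in> Ob C. \<forall>f \<in> Hom C A B. \<forall>x \<in> fobj F A.
        \<phi> B (fmap F A B f x) = fmap G A B f (\<phi> A x))"

definition nat_iso :: "('o, 'e) concrete_cat \<Rightarrow> ('o, 'e, 'x) set_fun \<Rightarrow> ('o, 'e, 'y) set_fun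
    \<Rightarrow> ('o \<Rightarrow> 'x \<Rightarrow> 'y) \<Rightarrow> bool" where
  "nat_iso C F G \<phi> \<longleftrightarrow>
     nat_trans C F G \<phi> \<and> (\<forall>A \<in> Ob C. bij_betw (\<phi> A) (fobj F A) (fobj G A))"

definition subfunctor :: "('o, 'e) concrete_cat \<Rightarrow> ('o, 'e, 'x) set_fun \<Rightarrow> ('o, 'e, 'x) set_fun
    \<Rightarrow> bool" where
  "subfunctor C G F \<longleftrightarrow> set_functor C G \<and>
     (\<forall>A \<in> Ob C. fobj G A \<subseteq> fobj F A) \<and>
     (\<forall>A \<in> Ob C. \<forall>B \<in> Ob C. \<forall>f \<in> Hom C A B. \<forall>x \<in> fobj G A. fmap G A B f x = fmap F A B f x)"

definition disjoint_union :: "'i set \<Rightarrow> ('i \<Rightarrow> ('o, 'e, 'x) set_fun) \<Rightarrow> ('o, 'e, 'i \<times> 'x) set_fun"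
  where
  "disjoint_union I F = \<lparr>fobj = (\<lambda>A. SIGMA i:I. fobj (F i) A),
     fmap = (\<lambda>A B f z. (fst z, fmap (F (fst z)) A B f (snd z)))\<rparr>"

definition restrict_F1 :: "('h option, 'x) mo_fun \<Rightarrow> ('h, 'x) ab_fun" where
  "restrict_F1 F = \<lparr>fobj = (\<lambda>H. fobj F (F1 H)),
     fmap = (\<lambda>H K h. fmap F (F1 H) (F1 K) (F1_map H h))\<rparr>"

text \<open>\<open>H \<mapsto> Hom\<^sub>A\<^sub>b(A, H)\<close>; the elements of \<open>A\<close> may live in another type than those of \<open>H\<close>.\<close>

definition ab_hom_functor :: "'a monoid \<Rightarrow> ('h, 'a \<Rightarrow> 'h) ab_fun" where
  "ab_hom_functor A = \<lparr>fobj = (\<lambda>H. ab_hom A H), fmap = (\<lambda>H K h u. compose (carrier A) h u)\<rparr>"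


section \<open>Mo-schemes\<close>

definition spec :: "'u monoid0 \<Rightarrow> ('u, 'u \<Rightarrow> 'u) mo_fun" where
  "spec M = \<lparr>fobj = (\<lambda>N. mo_hom M N), fmap = (\<lambda>N N' \<rho> f. compose (carrier M) \<rho> f)\<rparr>"

definition open_subfunctor :: "('u, 'x) mo_fun \<Rightarrow> ('u, 'x) mo_fun \<Rightarrow> bool" where
  "open_subfunctor G F \<longleftrightarrow> subfunctor Mo G F \<and>
     (\<forall>M \<in> Ob Mo. \<forall>\<phi>. nat_trans Mo (spec M) F \<phi> \<longrightarrow>
        (\<exists>I. mo_ideal M I \<and>
           (\<forall>N \<in> Ob Mo. \<forall>\<rho> \<in> mo_hom M N.
              \<phi> N \<rho> \<in> fobj G N \<longleftrightarrow> (\<rho> ` I) <#>\<^bsub>N\<^esub> carrier N = carrier N)))"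

definition representable :: "('u, 'x) mo_fun \<Rightarrow> bool" where
  "representable F \<longleftrightarrow> (\<exists>M \<in> Ob Mo. \<exists>\<phi>. nat_iso Mo (spec M) F \<phi>)"

definition mo_scheme :: "('h option, 'x) mo_fun \<Rightarrow> bool" where
  "mo_scheme F \<longleftrightarrow> set_functor Mo F \<and>
     (\<exists>\<A>. (\<forall>G \<in> \<A>. open_subfunctor G F \<and> representable G) \<and>
        (\<forall>H :: 'h monoid. comm_group H \<longrightarrow> fobj F (F1 H) = (\<Union>G \<in> \<A>. fobj G (F1 H))))"


section \<open>Geometric spaces\<close>

text \<open>\<open>gres X U V\<close> is the restriction map from \<open>U\<close> to \<open>V \<subseteq> U\<close>.\<close>

record ('p, 's) gspace =
  gtop :: "'p topology"
  gsec :: "'p set \<Rightarrow> 's monoid0"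
  gres :: "'p set \<Rightarrow> 'p set \<Rightarrow> 's \<Rightarrow> 's"

locale geometric_space =
  fixes X :: "('p, 's) gspace"
  assumes sec_monoid: "openin (gtop X) U \<Longrightarrow> mo_monoid (gsec X U)"
    and res_hom: "\<lbrakk>openin (gtop X) U; openin (gtop X) V; V \<subseteq> U\<rbrakk>
      \<Longrightarrow> gres X U V \<in> mo_hom (gsec X U) (gsec X V)"
    and res_id: "\<lbrakk>openin (gtop X) U; s \<in> carrier (gsec X U)\<rbrakk> \<Longrightarrow> gres X U U s = s"
    and res_comp: "\<lbrakk>openin (gtop X) U; openin (gtop X) V; openin (gtop X) W; W \<subseteq> V; V \<subseteq> U;
        s \<in> carrier (gsec X U)\<rbrakk> \<Longrightarrow> gres X V W (gres X U V s) = gres X U W s"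
    and sheaf_separated: "\<lbrakk>\<And>U. U \<in> \<U> \<Longrightarrow> openin (gtop X) U;
        s \<in> carrier (gsec X (\<Union>\<U>)); t \<in> carrier (gsec X (\<Union>\<U>));
        \<And>U. U \<in> \<U> \<Longrightarrow> gres X (\<Union>\<U>) U s = gres X (\<Union>\<U>) U t\<rbrakk> \<Longrightarrow> s = t"
    and sheaf_gluing: "\<lbrakk>\<And>U. U \<in> \<U> \<Longrightarrow> openin (gtop X) U;
        \<And>U. U \<in> \<U> \<Longrightarrow> \<sigma> U \<in> carrier (gsec X U);
        \<And>U V. \<lbrakk>U \<in> \<U>; V \<in> \<U>\<rbrakk> \<Longrightarrow> gres X U (U \<inter> V) (\<sigma> U) = gres X V (U \<inter> V) (\<sigma> V)\<rbrakk>
      \<Longrightarrow> \<exists>s \<in> carrier (gsec X (\<Union>\<U>)). \<forall>U \<in> \<U>. gres X (\<Union>\<U>) U s = \<sigma> U"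

subsection \<open>Stalks\<close>

definition germ :: "('p, 's) gspace \<Rightarrow> 'p \<Rightarrow> 'p set \<Rightarrow> 's \<Rightarrow> ('p set \<times> 's) set" where
  "germ X x U s = {(V, t). openin (gtop X) V \<and> x \<in> V \<and> t \<in> carrier (gsec X V) \<and>
     (\<exists>W. openin (gtop X) W \<and> x \<in> W \<and> W \<subseteq> U \<inter> V \<and> gres X U W s = gres X V W t)}"

definition stalk :: "('p, 's) gspace \<Rightarrow> 'p \<Rightarrow> ('p set \<times> 's) set monoid0" where
  "stalk X x = \<lparr>
     carrier = {germ X x U s | U s. openin (gtop X) U \<and> x \<in> U \<and> s \<in> carrier (gsec X U)},
     mult = (\<lambda>a b. \<Union>(U, s) \<in> a. \<Union>(V, t) \<in> b.
       germ X x (U \<inter> V) (gres X U (U \<inter> V) s \<otimes>\<^bsub>gsec X (U \<inter> V)\<^esub> gres X V (U \<inter> V) t)),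
     one = germ X x (topspace (gtop X)) \<one>\<^bsub>gsec X (topspace (gtop X))\<^esub>,
     absorbing = germ X x (topspace (gtop X)) (absorbing (gsec X (topspace (gtop X))))\<rparr>"

subsection \<open>Morphisms\<close>

type_synonym ('p, 's, 'q, 't) gs_map = "('p \<Rightarrow> 'q) \<times> ('q set \<Rightarrow> 't \<Rightarrow> 's)"

definition preim :: "('p, 's) gspace \<Rightarrow> ('p, 's, 'q, 't) gs_map \<Rightarrow> 'q set \<Rightarrow> 'p set" where
  "preim X f V = {x \<in> topspace (gtop X). fst f x \<in> V}"

definition stalk_map :: "('p, 's) gspace \<Rightarrow> ('q, 't) gspace \<Rightarrow> ('p, 's, 'q, 't) gs_map \<Rightarrow> 'p
    \<Rightarrow> ('q set \<times> 't) set \<Rightarrow> ('p set \<times> 's) set" where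
  "stalk_map X Y f x = (\<lambda>a \<in> carrier (stalk Y (fst f x)).
     \<Union>(V, t) \<in> a. germ X x (preim X f V) (snd f V t))"

definition gs_hom :: "('p, 's) gspace \<Rightarrow> ('q, 't) gspace \<Rightarrow> ('p, 's, 'q, 't) gs_map set" where
  "gs_hom X Y = {f.
     continuous_map (gtop X) (gtop Y) (fst f) \<and> fst f \<in> extensional (topspace (gtop X)) \<and>
     snd f \<in> (\<Pi>\<^sub>E V \<in> {V. openin (gtop Y) V}. mo_hom (gsec Y V) (gsec X (preim X f V))) \<and>
     (\<forall>V W. openin (gtop Y) V \<longrightarrow> openin (gtop Y) W \<longrightarrow> W \<subseteq> V \<longrightarrow>
        (\<forall>t \<in> carrier (gsec Y V).
           snd f W (gres Y V W t) = gres X (preim X f V) (preim X f W) (snd f V t))) \<and>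
     (\<forall>x \<in> topspace (gtop X).
        local_mo_hom (stalk Y (fst f x)) (stalk X x) (stalk_map X Y f x))}"

definition gs_id :: "('p, 's) gspace \<Rightarrow> ('p, 's, 'p, 's) gs_map" where
  "gs_id X = (\<lambda>x \<in> topspace (gtop X). x,
     \<lambda>U \<in> {U. openin (gtop X) U}. \<lambda>s \<in> carrier (gsec X U). s)"

text \<open>The composite \<open>g \<circ> f\<close> of \<open>f : X \<rightarrow> Y\<close> and \<open>g : Y \<rightarrow> Z\<close>.\<close>

definition gs_comp :: "('p, 's) gspace \<Rightarrow> ('q, 't) gspace \<Rightarrow> ('r, 'v) gspace
    \<Rightarrow> ('q, 't, 'r, 'v) gs_map \<Rightarrow> ('p, 's, 'q, 't) gs_map \<Rightarrow> ('p, 's, 'r, 'v) gs_map" where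
  "gs_comp X Y Z g f = (compose (topspace (gtop X)) (fst g) (fst f),
     \<lambda>W \<in> {W. openin (gtop Z) W}. \<lambda>t \<in> carrier (gsec Z W). snd f (preim Y g W) (snd g W t))"

definition gs_isomorphic :: "('p, 's) gspace \<Rightarrow> ('q, 't) gspace \<Rightarrow> bool" where
  "gs_isomorphic X Y \<longleftrightarrow> (\<exists>f \<in> gs_hom X Y. \<exists>g \<in> gs_hom Y X.
     gs_comp X Y X g f = gs_id X \<and> gs_comp Y X Y f g = gs_id Y)"

definition open_subspace :: "('p, 's) gspace \<Rightarrow> 'p set \<Rightarrow> ('p, 's) gspace" where
  "open_subspace X U = \<lparr>gtop = subtopology (gtop X) U, gsec = gsec X, gres = gres X\<rparr>"


section \<open>The prime spectrum\<close>

definition Spec_open :: "'a monoid0 \<Rightarrow> 'a set \<Rightarrow> 'a set set" where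
  "Spec_open M I = {\<pp>. mo_prime M \<pp> \<and> \<not> I \<subseteq> \<pp>}"

definition Spec_top :: "'a monoid0 \<Rightarrow> 'a set topology" where
  "Spec_top M = topology (\<lambda>U. \<exists>I. mo_ideal M I \<and> U = Spec_open M I)"

lemma mo_ideal_mult:
  assumes "mo_monoid M" "mo_ideal M I" "i \<in> I" "m \<in> carrier M"
  shows "i \<otimes>\<^bsub>M\<^esub> m \<in> I" "m \<otimes>\<^bsub>M\<^esub> i \<in> I"
proof -
  interpret mo_monoid M by fact
  show *: "i \<otimes>\<^bsub>M\<^esub> m \<in> I"
    using assms unfolding mo_ideal_def set_mult_def by blast
  have "i \<in> carrier M"
    using assms unfolding mo_ideal_def by blast
  then show "m \<otimes>\<^bsub>M\<^esub> i \<in> I"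
    using * assms m_comm by metis
qed

lemma istopology_Spec:
  assumes M: "mo_monoid M"
  shows "istopology (\<lambda>U. \<exists>I. mo_ideal M I \<and> U = Spec_open M I)"
  unfolding istopology_def
proof (intro conjI allI impI)
  interpret mo_monoid M by fact
  fix S T
  assume "\<exists>I. mo_ideal M I \<and> S = Spec_open M I" "\<exists>I. mo_ideal M I \<and> T = Spec_open M I"
  then obtain I J where I: "mo_ideal M I" "S = Spec_open M I"
    and J: "mo_ideal M J" "T = Spec_open M J" by blast
  have "mo_ideal M (I \<inter> J)"
    using I(1) J(1) unfolding mo_ideal_def set_mult_def by blast
  moreover have "Spec_open M I \<inter> Spec_open M J = Spec_open M (I \<inter> J)"
  proof (intro equalityI subsetI)
    fix \<pp> assume p: "\<pp> \<in> Spec_open M I \<inter> Spec_open M J"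
    then obtain i j where ij: "i \<in> I" "i \<notin> \<pp>" "j \<in> J" "j \<notin> \<pp>"
      unfolding Spec_open_def by blast
    then have c: "i \<in> carrier M" "j \<in> carrier M"
      using I(1) J(1) unfolding mo_ideal_def by blast+
    then have "i \<otimes>\<^bsub>M\<^esub> j \<notin> \<pp>"
      using p ij unfolding Spec_open_def mo_prime_def by blast
    moreover have "i \<otimes>\<^bsub>M\<^esub> j \<in> I \<inter> J"
      using mo_ideal_mult[OF M I(1) ij(1) c(2)] mo_ideal_mult[OF M J(1) ij(3) c(1)] by blast
    ultimately show "\<pp> \<in> Spec_open M (I \<inter> J)"
      using p unfolding Spec_open_def by blast
  next
    fix \<pp> assume "\<pp> \<in> Spec_open M (I \<inter> J)"
    then show "\<pp> \<in> Spec_open M I \<inter> Spec_open M J"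
      unfolding Spec_open_def by blast
  qed
  ultimately show "\<exists>I. mo_ideal M I \<and> S \<inter> T = Spec_open M I"
    using I(2) J(2) by blast
next
  interpret mo_monoid M by fact
  fix \<K> assume "\<forall>K \<in> \<K>. \<exists>I. mo_ideal M I \<and> K = Spec_open M I"
  then obtain J where J: "\<And>K. K \<in> \<K> \<Longrightarrow> mo_ideal M (J K) \<and> K = Spec_open M (J K)"
    by metis
  let ?I = "insert (absorbing M) (\<Union>K \<in> \<K>. J K)"
  have "mo_ideal M ?I"
    using J absorbing_closed absorbing_mult unfolding mo_ideal_def set_mult_def by fastforce
  moreover have "\<Union>\<K> = Spec_open M ?I"
  proof (rule Set.set_eqI)
    fix \<pp>
    have "\<pp> \<in> \<Union>\<K> \<longleftrightarrow> (\<exists>K \<in> \<K>. \<pp> \<in> Spec_open M (J K))"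
      using J by blast
    also have "\<dots> \<longleftrightarrow> \<pp> \<in> Spec_open M ?I"
      unfolding Spec_open_def mo_prime_def mo_ideal_def by blast
    finally show "\<pp> \<in> \<Union>\<K> \<longleftrightarrow> \<pp> \<in> Spec_open M ?I" .
  qed
  ultimately show "\<exists>I. mo_ideal M I \<and> \<Union>\<K> = Spec_open M I"
    by blast
qed

lemma openin_Spec_top:
  assumes "mo_monoid M"
  shows "openin (Spec_top M) U \<longleftrightarrow> (\<exists>I. mo_ideal M I \<and> U = Spec_open M I)"
  unfolding Spec_top_def using topology_inverse'[OF istopology_Spec[OF assms]] by simp

lemma topspace_Spec_top:
  assumes "mo_monoid M"
  shows "topspace (Spec_top M) = {\<pp>. mo_prime M \<pp>}"
proof -
  interpret mo_monoid M by fact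
  have "mo_ideal M (carrier M)"
    using absorbing_closed unfolding mo_ideal_def set_mult_def by auto
  moreover have "{\<pp>. mo_prime M \<pp>} = Spec_open M (carrier M)"
    using one_closed unfolding Spec_open_def mo_prime_def by blast
  ultimately have "openin (Spec_top M) {\<pp>. mo_prime M \<pp>}"
    using openin_Spec_top[OF assms] by metis
  moreover have "topspace (Spec_top M) \<subseteq> {\<pp>. mo_prime M \<pp>}"
    using openin_Spec_top[OF assms, of "topspace (Spec_top M)"] unfolding Spec_open_def by auto
  ultimately show ?thesis
    using openin_subset by blast
qed

text \<open>\<open>Spec \<bbbF>\<^sub>1[H]\<close> has exactly one point.\<close>

lemma mo_prime_F1:
  assumes "comm_group H"
  shows "mo_prime (F1 H) \<pp> \<longleftrightarrow> \<pp> = {None}"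
proof
  interpret comm_group H by fact
  assume p: "mo_prime (F1 H) \<pp>"
  have "Some g \<notin> \<pp>" for g
  proof
    assume g: "Some g \<in> \<pp>"
    then have "g \<in> carrier H"
      using p unfolding mo_prime_def mo_ideal_def F1_def by auto
    then have "Some g \<otimes>\<^bsub>F1 H\<^esub> Some (inv\<^bsub>H\<^esub> g) = Some \<one>\<^bsub>H\<^esub>"
      and "Some (inv\<^bsub>H\<^esub> g) \<in> carrier (F1 H)"
      by (simp_all add: F1_def)
    then have "Some \<one>\<^bsub>H\<^esub> \<in> \<pp> <#>\<^bsub>F1 H\<^esub> carrier (F1 H)"
      using g unfolding set_mult_def by (metis (mono_tags, lifting) UN_iff singletonI)
    then show False
      using p unfolding mo_prime_def mo_ideal_def by (auto simp: F1_def)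
  qed
  moreover have "None \<in> \<pp>"
    using p unfolding mo_prime_def mo_ideal_def F1_def by auto
  ultimately have "x \<in> \<pp> \<longleftrightarrow> x = None" for x
    by (cases x) simp_all
  then show "\<pp> = {None}"
    by (intro Set.set_eqI) simp
next
  interpret comm_group H by fact
  assume "\<pp> = {None}"
  then show "mo_prime (F1 H) \<pp>"
    unfolding mo_prime_def mo_ideal_def set_mult_def F1_def by auto
qed

text \<open>A section over \<open>U\<close> assigns to every \<open>\<pp> \<in> U\<close> an element of the localization at \<open>\<pp>\<close>, and is
  locally given by a single fraction.\<close>

definition Spec_sec :: "'a monoid0 \<Rightarrow> 'a set set \<Rightarrow> ('a set \<Rightarrow> ('a \<times> 'a) set) monoid0" where
  "Spec_sec M U = \<lparr>
     carrier = {s \<in> (\<Pi>\<^sub>E \<pp> \<in> U. carrier (loc_at M \<pp>)).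
       \<forall>\<pp> \<in> U. \<exists>V. openin (Spec_top M) V \<and> \<pp> \<in> V \<and> V \<subseteq> U \<and>
         (\<exists>a \<in> carrier M. \<exists>f \<in> carrier M. \<forall>\<qq> \<in> V. f \<notin> \<qq> \<and> s \<qq> = frac M (carrier M - \<qq>) a f)},
     mult = (\<lambda>s t. \<lambda>\<pp> \<in> U. s \<pp> \<otimes>\<^bsub>loc_at M \<pp>\<^esub> t \<pp>),
     one = (\<lambda>\<pp> \<in> U. \<one>\<^bsub>loc_at M \<pp>\<^esub>),
     absorbing = (\<lambda>\<pp> \<in> U. absorbing (loc_at M \<pp>))\<rparr>"

text \<open>Extensionality of restriction maps requires the outer restriction to \<open>Spec_sec M U\<close>.\<close>

definition Spec :: "'a monoid0 \<Rightarrow> ('a set, 'a set \<Rightarrow> ('a \<times> 'a) set) gspace" where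
  "Spec M = \<lparr>gtop = Spec_top M, gsec = Spec_sec M,
     gres = (\<lambda>U V. \<lambda>s \<in> carrier (Spec_sec M U). restrict s V)\<rparr>"

text \<open>The morphism \<open>Spec N' \<rightarrow> Spec N\<close> induced by \<open>\<rho> : N \<rightarrow> N'\<close>: inverse image on primes, and
  \<open>a / f \<mapsto> \<rho> a / \<rho> f\<close> on sections.\<close>

definition Spec_map :: "'a monoid0 \<Rightarrow> 'a monoid0 \<Rightarrow> ('a \<Rightarrow> 'a)
    \<Rightarrow> ('a set, 'a set \<Rightarrow> ('a \<times> 'a) set, 'a set, 'a set \<Rightarrow> ('a \<times> 'a) set) gs_map" where
  "Spec_map N N' \<rho> = (let inv_im = (\<lambda>\<pp>. {a \<in> carrier N. \<rho> a \<in> \<pp>}) in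
     (\<lambda>\<pp> \<in> {\<pp>. mo_prime N' \<pp>}. inv_im \<pp>,
      \<lambda>V \<in> {V. openin (Spec_top N) V}. \<lambda>s \<in> carrier (Spec_sec N V).
        \<lambda>\<pp> \<in> {\<pp>. mo_prime N' \<pp> \<and> inv_im \<pp> \<in> V}.
          \<Union>(a, f) \<in> s (inv_im \<pp>). frac N' (carrier N' - \<pp>) (\<rho> a) (\<rho> f)))"


section \<open>Geometric realization\<close>

text \<open>The type argument is the universe from which the affine charts are taken.\<close>

definition geometric_scheme :: "'u itself \<Rightarrow> ('p, 's) gspace \<Rightarrow> bool" where
  "geometric_scheme (_ :: 'u itself) X \<longleftrightarrow> geometric_space X \<and>
     (\<exists>\<U>. \<Union>\<U> = topspace (gtop X) \<and>
        (\<forall>U \<in> \<U>. openin (gtop X) U \<and>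
           (\<exists>M :: 'u monoid0. mo_monoid M \<and> gs_isomorphic (open_subspace X U) (Spec M))))"

definition hom_Spec :: "('p, 's) gspace
    \<Rightarrow> ('u, ('u set, 'u set \<Rightarrow> ('u \<times> 'u) set, 'p, 's) gs_map) mo_fun" where
  "hom_Spec X = \<lparr>fobj = (\<lambda>N. gs_hom (Spec N) X),
     fmap = (\<lambda>N N' \<rho> \<phi>. gs_comp (Spec N') (Spec N) X \<phi> (Spec_map N N' \<rho>))\<rparr>"

text \<open>\<open>\<eta>\<close> is the natural identification of \<open>F(N)\<close> with \<open>Hom(Spec N, X)\<close>, which is part of the data.\<close>

definition geometric_realization :: "('u, 'x) mo_fun \<Rightarrow> ('p, 's) gspace
    \<Rightarrow> ('u monoid0 \<Rightarrow> 'x \<Rightarrow> ('u set, 'u set \<Rightarrow> ('u \<times> 'u) set, 'p, 's) gs_map) \<Rightarrow> bool" where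
  "geometric_realization F X \<eta> \<longleftrightarrow>
     geometric_scheme TYPE('u) X \<and> nat_iso Mo F (hom_Spec X) \<eta>"

end

theory Submission
  imports Defs
begin

text \<open>\<open>Spec \<bbbF>\<^sub>1[H]\<close> has a single point, whose stalk is \<open>\<bbbF>\<^sub>1[H]\<close>, and its only other open set is
  empty. A morphism to \<open>X\<close> is therefore a point \<open>x\<close> together with a local morphism
  \<open>\<O>\<^sub>x \<rightarrow> \<bbbF>\<^sub>1[H]\<close>. Locality forces the non-units to zero, so such a morphism is the same as a
  group homomorphism \<open>\<O>\<^sub>x\<^sup>\<times> \<rightarrow> H\<close>. Conversely the extension by zero is a morphism because the
  stalks of a scheme, being localizations at primes, satisfy \<open>1 \<noteq> 0\<close>.\<close>

text \<open>Sections, stalks and localizations are concrete sets of classes, and a product of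
  classes is a union over all representatives. Computing with them takes two facts: a class is
  determined by any of its members, and all products of representatives agree;
  \<open>UN_pairs_constant\<close> then collapses the union. The stalk of the one-point spectrum is
  only an encoded copy of F1[H]. The bijection is therefore built in two stages: morphisms against
  pairs of a point and a local map into F1[H] itself (\<open>stalk_val\<close> decodes,
  \<open>F1_point\<close> encodes), then local maps against homomorphisms on units. The first stage
  works over any geometric space. The second would fail at a point with zero stalk: its unit group
  is trivial and has one homomorphism to H, while no map can send 1 = 0 both to 1 and to 0, so such
  a point would be counted on one side only. A morphism to X also has values over open sets that
  miss its point. They are sections over the empty set, of which there is exactly one, so they carry
  no information.\<close>

lemma UN_pairs_constant:
  assumes "(a, b) \<in> A" "(c, d) \<in> B"
    and "\<And>a b c d. (a, b) \<in> A \<Longrightarrow> (c, d) \<in> B \<Longrightarrow> F a b c d = R"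
  shows "(\<Union>(a, b) \<in> A. \<Union>(c, d) \<in> B. F a b c d) = R"
proof -
  have "(\<Union>(a, b) \<in> A. \<Union>(c, d) \<in> B. F a b c d) = (\<Union>p \<in> A. \<Union>q \<in> B. R)"
    by (intro SUP_cong) (auto simp: assms(3))
  then show ?thesis
    using assms(1,2) by auto
qed

section \<open>Localization\<close>

lemma frac_self:
  assumes "mo_monoid M" "S \<subseteq> carrier M" "\<one>\<^bsub>M\<^esub> \<in> S" "a \<in> carrier M" "f \<in> S"
  shows "(a, f) \<in> frac M S a f"
proof -
  interpret mo_monoid M by fact
  show ?thesis
    using assms unfolding frac_def by blast
qed

text \<open>Transitivity of the fraction relation without cancellation. With h witnessing a/f = c/k
  and h' witnessing a/f = b/g, the element h h' f witnesses b/g = c/k: the shared denominator f has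
  to be absorbed into the witness. The other inclusion follows by symmetry.\<close>

lemma frac_eqI:
  assumes M: "mo_monoid M" and S: "S \<subseteq> carrier M" "\<one>\<^bsub>M\<^esub> \<in> S"
    "\<And>a b. a \<in> S \<Longrightarrow> b \<in> S \<Longrightarrow> a \<otimes>\<^bsub>M\<^esub> b \<in> S"
    and a: "a \<in> carrier M" "f \<in> S" and b: "(b, g) \<in> frac M S a f"
  shows "frac M S b g = frac M S a f"
proof -
  interpret mo_monoid M by fact
  have sub: "frac M S a f \<subseteq> frac M S b g"
    if a: "a \<in> carrier M" "f \<in> S" and b: "(b, g) \<in> frac M S a f" for a f b g
  proof clarify
    fix c k assume "(c, k) \<in> frac M S a f"
    then obtain h where c: "c \<in> carrier M" "k \<in> S" "h \<in> S"
      "h \<otimes>\<^bsub>M\<^esub> (k \<otimes>\<^bsub>M\<^esub> a) = h \<otimes>\<^bsub>M\<^esub> (f \<otimes>\<^bsub>M\<^esub> c)"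
      unfolding frac_def by blast
    obtain h' where d: "b \<in> carrier M" "g \<in> S" "h' \<in> S"
      "h' \<otimes>\<^bsub>M\<^esub> (g \<otimes>\<^bsub>M\<^esub> a) = h' \<otimes>\<^bsub>M\<^esub> (f \<otimes>\<^bsub>M\<^esub> b)"
      using b unfolding frac_def by blast
    have cl: "f \<in> carrier M" "g \<in> carrier M" "k \<in> carrier M" "h \<in> carrier M" "h' \<in> carrier M"
      using S(1) a c d by auto
    have "(h \<otimes>\<^bsub>M\<^esub> h' \<otimes>\<^bsub>M\<^esub> f) \<otimes>\<^bsub>M\<^esub> (k \<otimes>\<^bsub>M\<^esub> b)
        = (h \<otimes>\<^bsub>M\<^esub> k) \<otimes>\<^bsub>M\<^esub> (h' \<otimes>\<^bsub>M\<^esub> (f \<otimes>\<^bsub>M\<^esub> b))"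
      using a c(1,2,3) d(1,2,3) cl by (simp add: m_ac)
    also have "\<dots> = (h' \<otimes>\<^bsub>M\<^esub> g) \<otimes>\<^bsub>M\<^esub> (h \<otimes>\<^bsub>M\<^esub> (k \<otimes>\<^bsub>M\<^esub> a))"
      unfolding d(4)[symmetric] using a c(1,2,3) d(1,2,3) cl by (simp add: m_ac)
    also have "\<dots> = (h \<otimes>\<^bsub>M\<^esub> h' \<otimes>\<^bsub>M\<^esub> f) \<otimes>\<^bsub>M\<^esub> (g \<otimes>\<^bsub>M\<^esub> c)"
      unfolding c(4) using a c(1,2,3) d(1,2,3) cl by (simp add: m_ac)
    finally show "(c, k) \<in> frac M S b g"
      unfolding frac_def using c d a S(3) by blast
  qed
  have "(a, f) \<in> frac M S b g"
    using b a unfolding frac_def by force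
  moreover have "b \<in> carrier M" "g \<in> S"
    using b unfolding frac_def by blast+
  ultimately show ?thesis
    using sub a b by blast
qed

lemma localization_mult_frac:
  assumes M: "mo_monoid M" and S: "S \<subseteq> carrier M" "\<one>\<^bsub>M\<^esub> \<in> S"
    "\<And>a b. a \<in> S \<Longrightarrow> b \<in> S \<Longrightarrow> a \<otimes>\<^bsub>M\<^esub> b \<in> S"
    and a: "a \<in> carrier M" "f \<in> S" and b: "b \<in> carrier M" "g \<in> S"
  shows "frac M S a f \<otimes>\<^bsub>localization M S\<^esub> frac M S b g = frac M S (a \<otimes>\<^bsub>M\<^esub> b) (f \<otimes>\<^bsub>M\<^esub> g)"
proof -
  interpret mo_monoid M by fact
  have eq: "frac M S (a' \<otimes>\<^bsub>M\<^esub> b') (f' \<otimes>\<^bsub>M\<^esub> g') = frac M S (a \<otimes>\<^bsub>M\<^esub> b) (f \<otimes>\<^bsub>M\<^esub> g)"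
    if a': "(a', f') \<in> frac M S a f" and b': "(b', g') \<in> frac M S b g" for a' f' b' g'
  proof (rule frac_eqI[OF M S])
    obtain h where c: "a' \<in> carrier M" "f' \<in> S" "h \<in> S"
      "h \<otimes>\<^bsub>M\<^esub> (f' \<otimes>\<^bsub>M\<^esub> a) = h \<otimes>\<^bsub>M\<^esub> (f \<otimes>\<^bsub>M\<^esub> a')"
      using a' unfolding frac_def by blast
    obtain k where d: "b' \<in> carrier M" "g' \<in> S" "k \<in> S"
      "k \<otimes>\<^bsub>M\<^esub> (g' \<otimes>\<^bsub>M\<^esub> b) = k \<otimes>\<^bsub>M\<^esub> (g \<otimes>\<^bsub>M\<^esub> b')"
      using b' unfolding frac_def by blast
    have cl: "f \<in> carrier M" "g \<in> carrier M" "f' \<in> carrier M" "g' \<in> carrier M"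
      "h \<in> carrier M" "k \<in> carrier M"
      using S(1) a b c d by auto
    have "(h \<otimes>\<^bsub>M\<^esub> k) \<otimes>\<^bsub>M\<^esub> ((f' \<otimes>\<^bsub>M\<^esub> g') \<otimes>\<^bsub>M\<^esub> (a \<otimes>\<^bsub>M\<^esub> b))
        = (h \<otimes>\<^bsub>M\<^esub> (f' \<otimes>\<^bsub>M\<^esub> a)) \<otimes>\<^bsub>M\<^esub> (k \<otimes>\<^bsub>M\<^esub> (g' \<otimes>\<^bsub>M\<^esub> b))"
      using a b c(1-3) d(1-3) cl by (simp add: m_ac)
    also have "\<dots> = (h \<otimes>\<^bsub>M\<^esub> k) \<otimes>\<^bsub>M\<^esub> ((f \<otimes>\<^bsub>M\<^esub> g) \<otimes>\<^bsub>M\<^esub> (a' \<otimes>\<^bsub>M\<^esub> b'))"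
      unfolding c(4) d(4) using a b c(1-3) d(1-3) cl by (simp add: m_ac)
    finally show "(a' \<otimes>\<^bsub>M\<^esub> b', f' \<otimes>\<^bsub>M\<^esub> g') \<in> frac M S (a \<otimes>\<^bsub>M\<^esub> b) (f \<otimes>\<^bsub>M\<^esub> g)"
      unfolding frac_def using c(1-3) d(1-3) S(3) by blast
  qed (use a b S in auto)
  show ?thesis
    using UN_pairs_constant[OF frac_self[OF M S(1,2) a] frac_self[OF M S(1,2) b] eq]
    by (simp add: localization_def)
qed

text \<open>An equality 1/1 = 0/1 is witnessed by some h in S with h 0 = h, which puts 0 into
  S.\<close>

lemma localization_one_neq_absorbing:
  assumes M: "mo_monoid M" and S: "S \<subseteq> carrier M" "\<one>\<^bsub>M\<^esub> \<in> S" "absorbing M \<notin> S"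
  shows "\<one>\<^bsub>localization M S\<^esub> \<noteq> absorbing (localization M S)"
proof
  interpret mo_monoid M by fact
  assume "\<one>\<^bsub>localization M S\<^esub> = absorbing (localization M S)"
  then have "(\<one>\<^bsub>M\<^esub>, \<one>\<^bsub>M\<^esub>) \<in> frac M S (absorbing M) \<one>\<^bsub>M\<^esub>"
    using frac_self[OF M S(1,2) one_closed S(2)] by (simp add: localization_def)
  then obtain h where "h \<in> S" "h \<otimes>\<^bsub>M\<^esub> absorbing M = h"
    using S(1) absorbing_closed unfolding frac_def by auto
  then show False
    using S absorbing_mult absorbing_closed m_comm by (metis subsetD)
qed


section \<open>Stalks\<close>

context geometric_space
begin

lemma res_closed:
  "\<lbrakk>openin (gtop X) U; openin (gtop X) V; V \<subseteq> U; s \<in> carrier (gsec X U)\<rbrakk>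
    \<Longrightarrow> gres X U V s \<in> carrier (gsec X V)"
  using res_hom unfolding mo_hom_def hom_def by blast

lemma res_mult:
  "\<lbrakk>openin (gtop X) U; openin (gtop X) V; V \<subseteq> U; s \<in> carrier (gsec X U); t \<in> carrier (gsec X U)\<rbrakk>
    \<Longrightarrow> gres X U V (s \<otimes>\<^bsub>gsec X U\<^esub> t) = gres X U V s \<otimes>\<^bsub>gsec X V\<^esub> gres X U V t"
  using res_hom unfolding mo_hom_def hom_def by blast

lemma res_one:
  "\<lbrakk>openin (gtop X) U; openin (gtop X) V; V \<subseteq> U\<rbrakk> \<Longrightarrow> gres X U V \<one>\<^bsub>gsec X U\<^esub> = \<one>\<^bsub>gsec X V\<^esub>"
  using res_hom unfolding mo_hom_def by blast

lemma res_absorbing: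
  "\<lbrakk>openin (gtop X) U; openin (gtop X) V; V \<subseteq> U\<rbrakk>
    \<Longrightarrow> gres X U V (absorbing (gsec X U)) = absorbing (gsec X V)"
  using res_hom unfolding mo_hom_def by blast

lemma sec_closed:
  assumes "openin (gtop X) U"
  shows "\<one>\<^bsub>gsec X U\<^esub> \<in> carrier (gsec X U)" "absorbing (gsec X U) \<in> carrier (gsec X U)"
    "s \<in> carrier (gsec X U) \<Longrightarrow> t \<in> carrier (gsec X U) \<Longrightarrow> s \<otimes>\<^bsub>gsec X U\<^esub> t \<in> carrier (gsec X U)"
proof -
  interpret mo_monoid "gsec X U" using sec_monoid assms by blast
  show "\<one>\<^bsub>gsec X U\<^esub> \<in> carrier (gsec X U)" "absorbing (gsec X U) \<in> carrier (gsec X U)"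
    "s \<in> carrier (gsec X U) \<Longrightarrow> t \<in> carrier (gsec X U) \<Longrightarrow> s \<otimes>\<^bsub>gsec X U\<^esub> t \<in> carrier (gsec X U)"
    using absorbing_closed by auto
qed

lemma germ_self:
  "\<lbrakk>openin (gtop X) U; x \<in> U; s \<in> carrier (gsec X U)\<rbrakk> \<Longrightarrow> (U, s) \<in> germ X x U s"
  unfolding germ_def by blast

text \<open>Transitivity of agreement near x: agreement on W and agreement on W' are compared on the
  intersection, where \<open>res_comp\<close> identifies all routes. \<open>germ_eqI\<close> adds
  the reverse inclusion by symmetry.\<close>

lemma germ_mono:
  assumes U: "openin (gtop X) U" "s \<in> carrier (gsec X U)" and V: "(V, t) \<in> germ X x U s"
  shows "germ X x V t \<subseteq> germ X x U s"
proof clarify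
  obtain W where W: "openin (gtop X) W" "x \<in> W" "W \<subseteq> U \<inter> V" "gres X U W s = gres X V W t"
    and t: "openin (gtop X) V" "t \<in> carrier (gsec X V)"
    using V unfolding germ_def by blast
  fix V' t' assume "(V', t') \<in> germ X x V t"
  then obtain W' where W': "openin (gtop X) W'" "x \<in> W'" "W' \<subseteq> V \<inter> V'"
      "gres X V W' t = gres X V' W' t'"
    and t': "openin (gtop X) V'" "x \<in> V'" "t' \<in> carrier (gsec X V')"
    unfolding germ_def by blast
  let ?W = "W \<inter> W'"
  have o: "openin (gtop X) ?W" using W(1) W'(1) by blast
  have "gres X U ?W s = gres X W ?W (gres X U W s)"
    by (rule res_comp[symmetric]) (use U W o in auto)
  also have "\<dots> = gres X V ?W t"
    unfolding W(4) by (rule res_comp) (use t W o in auto)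
  also have "\<dots> = gres X W' ?W (gres X V W' t)"
    by (rule res_comp[symmetric]) (use t W' o in auto)
  also have "\<dots> = gres X V' ?W t'"
    unfolding W'(4) by (rule res_comp) (use t' W' o in auto)
  finally show "(V', t') \<in> germ X x U s"
    unfolding germ_def using t' o W W' by blast
qed

lemma germ_eqI:
  assumes "openin (gtop X) U" "x \<in> U" "s \<in> carrier (gsec X U)" "(V, t) \<in> germ X x U s"
  shows "germ X x V t = germ X x U s"
proof -
  have V: "openin (gtop X) V" "t \<in> carrier (gsec X V)" and "(U, s) \<in> germ X x V t"
    using assms unfolding germ_def by (blast, blast, force)
  then show ?thesis
    using germ_mono assms by (metis subset_antisym)
qed

lemma germ_res:
  assumes "openin (gtop X) U" "openin (gtop X) V" "V \<subseteq> U" "x \<in> V" "s \<in> carrier (gsec X U)"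
  shows "germ X x V (gres X U V s) = germ X x U s"
proof (rule germ_eqI)
  have "gres X U V s = gres X V V (gres X U V s)"
    using assms res_closed res_id by simp
  then show "(V, gres X U V s) \<in> germ X x U s"
    unfolding germ_def using assms res_closed by blast
qed (use assms in auto)

text \<open>Both factors live on one U, where the product involves no restriction;
  \<open>stalk_common\<close> reduces everything to this case. Any other representatives v and v'
  agree with s and t on W \<inter> W', so their product has the same germ.\<close>

lemma stalk_mult_germ:
  assumes U: "openin (gtop X) U" "x \<in> U" "s \<in> carrier (gsec X U)" "t \<in> carrier (gsec X U)"
  shows "germ X x U s \<otimes>\<^bsub>stalk X x\<^esub> germ X x U t = germ X x U (s \<otimes>\<^bsub>gsec X U\<^esub> t)"
proof -
  have eq: "germ X x (V \<inter> V') (gres X V (V \<inter> V') v \<otimes>\<^bsub>gsec X (V \<inter> V')\<^esub> gres X V' (V \<inter> V') v')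
      = germ X x U (s \<otimes>\<^bsub>gsec X U\<^esub> t)"
    if V: "(V, v) \<in> germ X x U s" and V': "(V', v') \<in> germ X x U t" for V v V' v'
  proof -
    obtain W where W: "openin (gtop X) W" "x \<in> W" "W \<subseteq> U \<inter> V" "gres X U W s = gres X V W v"
      and v: "openin (gtop X) V" "x \<in> V" "v \<in> carrier (gsec X V)"
      using V unfolding germ_def by blast
    obtain W' where W': "openin (gtop X) W'" "x \<in> W'" "W' \<subseteq> U \<inter> V'"
        "gres X U W' t = gres X V' W' v'"
      and v': "openin (gtop X) V'" "x \<in> V'" "v' \<in> carrier (gsec X V')"
      using V' unfolding germ_def by blast
    let ?W = "W \<inter> W'" and ?V = "V \<inter> V'"
    let ?p = "gres X V ?V v \<otimes>\<^bsub>gsec X ?V\<^esub> gres X V' ?V v'"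
    have o: "openin (gtop X) ?W" "openin (gtop X) ?V" "?W \<subseteq> ?V" "?W \<subseteq> U" "x \<in> ?W" "x \<in> ?V"
      using W W' v v' by auto
    have r: "gres X V ?V v \<in> carrier (gsec X ?V)" "gres X V' ?V v' \<in> carrier (gsec X ?V)"
      using res_closed v v' o by auto
    have "gres X V ?W v = gres X W ?W (gres X V W v)"
      by (rule res_comp[symmetric]) (use W v o in auto)
    also have "\<dots> = gres X U ?W s"
      unfolding W(4)[symmetric] by (rule res_comp) (use W U o in auto)
    finally have 1: "gres X V ?W v = gres X U ?W s" .
    have "gres X V' ?W v' = gres X W' ?W (gres X V' W' v')"
      by (rule res_comp[symmetric]) (use W' v' o in auto)
    also have "\<dots> = gres X U ?W t"
      unfolding W'(4)[symmetric] by (rule res_comp) (use W' U o in auto)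
    finally have 2: "gres X V' ?W v' = gres X U ?W t" .
    have "gres X ?V ?W (gres X V ?V v) = gres X V ?W v"
      by (rule res_comp) (use v o in auto)
    moreover have "gres X ?V ?W (gres X V' ?V v') = gres X V' ?W v'"
      by (rule res_comp) (use v' o in auto)
    ultimately have "gres X ?V ?W ?p = gres X U ?W (s \<otimes>\<^bsub>gsec X U\<^esub> t)"
      unfolding res_mult[OF o(2,1,3) r] res_mult[OF U(1) o(1,4) U(3,4)] 1 2 by simp
    then show ?thesis
      using germ_res[OF o(2,1,3,5) sec_closed(3)[OF o(2) r]]
        germ_res[OF U(1) o(1,4,5) sec_closed(3)[OF U(1,3,4)]] by simp
  qed
  show ?thesis
    using UN_pairs_constant[OF germ_self[OF U(1,2,3)] germ_self[OF U(1,2,4)] eq]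
    by (simp add: stalk_def)
qed

lemma germ_in_stalk:
  "\<lbrakk>openin (gtop X) U; x \<in> U; s \<in> carrier (gsec X U)\<rbrakk> \<Longrightarrow> germ X x U s \<in> carrier (stalk X x)"
  unfolding stalk_def by auto

lemma stalk_one_germ:
  assumes "openin (gtop X) U" "x \<in> U"
  shows "\<one>\<^bsub>stalk X x\<^esub> = germ X x U \<one>\<^bsub>gsec X U\<^esub>"
proof -
  have top: "openin (gtop X) (topspace (gtop X))" "U \<subseteq> topspace (gtop X)"
    using openin_subset assms by auto
  show ?thesis
    using germ_res[OF top(1) assms(1) top(2) assms(2) sec_closed(1)[OF top(1)]]
    by (simp add: stalk_def res_one[OF top(1) assms(1) top(2)])
qed

lemma stalk_absorbing_germ:
  assumes "openin (gtop X) U" "x \<in> U"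
  shows "absorbing (stalk X x) = germ X x U (absorbing (gsec X U))"
proof -
  have top: "openin (gtop X) (topspace (gtop X))" "U \<subseteq> topspace (gtop X)"
    using openin_subset assms by auto
  show ?thesis
    using germ_res[OF top(1) assms(1) top(2) assms(2) sec_closed(2)[OF top(1)]]
    by (simp add: stalk_def res_absorbing[OF top(1) assms(1) top(2)])
qed

lemma stalkE:
  assumes "a \<in> carrier (stalk X x)"
  obtains U s where "openin (gtop X) U" "x \<in> U" "s \<in> carrier (gsec X U)" "a = germ X x U s"
  using assms unfolding stalk_def by auto


text \<open>Germs at x can be shrunk to a common neighbourhood, so an identity in the stalk follows
  from the same identity in a single section monoid. Three elements are what associativity
  takes.\<close>

lemma stalk_common:
  assumes "a \<in> carrier (stalk X x)" "b \<in> carrier (stalk X x)" "c \<in> carrier (stalk X x)"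
  obtains U s t u where "openin (gtop X) U" "x \<in> U"
    "s \<in> carrier (gsec X U)" "t \<in> carrier (gsec X U)" "u \<in> carrier (gsec X U)"
    "a = germ X x U s" "b = germ X x U t" "c = germ X x U u"
proof -
  obtain U s where U: "openin (gtop X) U" "x \<in> U" "s \<in> carrier (gsec X U)" "a = germ X x U s"
    using assms(1) by (rule stalkE)
  obtain V t where V: "openin (gtop X) V" "x \<in> V" "t \<in> carrier (gsec X V)" "b = germ X x V t"
    using assms(2) by (rule stalkE)
  obtain W u where W: "openin (gtop X) W" "x \<in> W" "u \<in> carrier (gsec X W)" "c = germ X x W u"
    using assms(3) by (rule stalkE)
  let ?O = "U \<inter> V \<inter> W"
  have o: "openin (gtop X) ?O" "x \<in> ?O" "?O \<subseteq> U" "?O \<subseteq> V" "?O \<subseteq> W"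
    using U V W by auto
  show thesis
  proof (rule that[of ?O "gres X U ?O s" "gres X V ?O t" "gres X W ?O u"])
    show "a = germ X x ?O (gres X U ?O s)" "b = germ X x ?O (gres X V ?O t)"
      "c = germ X x ?O (gres X W ?O u)"
      using germ_res o U V W by metis+
  qed (use o U V W res_closed in auto)
qed

lemma mo_monoid_stalk:
  assumes x: "x \<in> topspace (gtop X)"
  shows "mo_monoid (stalk X x)"
proof -
  have top: "openin (gtop X) (topspace (gtop X))" by simp
  have one: "\<one>\<^bsub>stalk X x\<^esub> \<in> carrier (stalk X x)"
    using stalk_one_germ[OF top x] germ_in_stalk[OF top x] sec_closed(1)[OF top] by simp
  have abs: "absorbing (stalk X x) \<in> carrier (stalk X x)"
    using stalk_absorbing_germ[OF top x] germ_in_stalk[OF top x] sec_closed(2)[OF top] by simp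
  \<comment> \<open>All laws are packed into one statement so that the passage to a common
    neighbourhood happens once.\<close>
  have laws: "a \<otimes>\<^bsub>stalk X x\<^esub> b \<in> carrier (stalk X x) \<and>
      a \<otimes>\<^bsub>stalk X x\<^esub> b \<otimes>\<^bsub>stalk X x\<^esub> c = a \<otimes>\<^bsub>stalk X x\<^esub> (b \<otimes>\<^bsub>stalk X x\<^esub> c) \<and>
      a \<otimes>\<^bsub>stalk X x\<^esub> b = b \<otimes>\<^bsub>stalk X x\<^esub> a \<and> \<one>\<^bsub>stalk X x\<^esub> \<otimes>\<^bsub>stalk X x\<^esub> a = a \<and>
      absorbing (stalk X x) \<otimes>\<^bsub>stalk X x\<^esub> a = absorbing (stalk X x)"
    if abc: "a \<in> carrier (stalk X x)" "b \<in> carrier (stalk X x)" "c \<in> carrier (stalk X x)" for a b c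
  proof -
    obtain U s t u where U: "openin (gtop X) U" "x \<in> U"
      and s: "s \<in> carrier (gsec X U)" "t \<in> carrier (gsec X U)" "u \<in> carrier (gsec X U)"
      and e: "a = germ X x U s" "b = germ X x U t" "c = germ X x U u"
      using abc by (rule stalk_common)
    interpret mo_monoid "gsec X U" using sec_monoid U by blast
    \<comment> \<open>\<open>m_ac\<close> may order the absorbing element to the right, where
      \<open>absorbing_mult\<close> does not match.\<close>
    have "s \<otimes>\<^bsub>gsec X U\<^esub> absorbing (gsec X U) = absorbing (gsec X U)"
      using absorbing_mult absorbing_closed m_comm s by metis
    then show ?thesis
      unfolding e stalk_one_germ[OF U] stalk_absorbing_germ[OF U]
      using U s
      by (simp add: stalk_mult_germ germ_in_stalk m_ac absorbing_closed absorbing_mult)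
  qed
  have "comm_monoid (stalk X x)"
    by (rule comm_monoidI) (metis one laws)+
  then show ?thesis
    unfolding mo_monoid_def mo_monoid_axioms_def using abs laws[OF _ abs abs] by simp
qed

end

section \<open>The spectrum of \<open>\<bbbF>\<^sub>1[H]\<close>\<close>

lemma mo_monoid_F1:
  assumes "comm_group H"
  shows "mo_monoid (F1 H)"
proof -
  interpret comm_group H by fact
  have "comm_monoid (F1 H)"
    by (rule comm_monoidI) (auto simp: F1_def m_ac)
  then show ?thesis
    unfolding mo_monoid_def mo_monoid_axioms_def by (auto simp: F1_def)
qed

lemma Units_F1:
  assumes "comm_group H"
  shows "Units (F1 H) = Some ` carrier H"
proof -
  interpret comm_group H by fact
  have "Some g \<in> Units (F1 H)" if "g \<in> carrier H" for g
    unfolding Units_def using that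
    by (auto simp: F1_def intro!: bexI[of _ "inv\<^bsub>H\<^esub> g"])
  then show ?thesis
    by (auto simp: Units_def F1_def)
qed

lemma F1_map_mo_hom:
  assumes "comm_group H" "comm_group K" "h \<in> ab_hom H K"
  shows "F1_map H h \<in> mo_hom (F1 H) (F1 K)"
proof -
  interpret H: comm_group H by fact
  interpret K: comm_group K by fact
  have h: "h \<in> hom H K" using assms(3) unfolding ab_hom_def by blast
  then have "h \<one>\<^bsub>H\<^esub> = \<one>\<^bsub>K\<^esub>"
    using hom_one H.is_group K.is_group by blast
  then show ?thesis
    using h unfolding mo_hom_def F1_map_def F1_def hom_def by auto
qed

text \<open>Two facts about units make the extension by zero a morphism. In a commutative monoid a
  product is a unit only if both factors are, which gives multiplicativity; and 1 \<noteq> 0 keeps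
  the absorbing element out of the units, so that it is sent to \<open>None\<close>.\<close>

lemma bij_betw_local_mo_hom_F1:
  assumes M: "mo_monoid M" and H: "comm_group H" and ne: "\<one>\<^bsub>M\<^esub> \<noteq> absorbing M"
  shows "bij_betw (\<lambda>\<sigma>. \<lambda>u\<in>Units M. the (\<sigma> u)) {\<sigma>. local_mo_hom M (F1 H) \<sigma>} (ab_hom (units_of M) H)"
proof (rule bij_betw_byWitness[where f' = "\<lambda>g. \<lambda>a\<in>carrier M. if a \<in> Units M then Some (g a) else None"])
  interpret mo_monoid M by fact
  interpret H: comm_group H by fact
  have zero: "absorbing M \<notin> Units M"
  proof
    assume "absorbing M \<in> Units M"
    then obtain a where "a \<in> carrier M" "absorbing M \<otimes>\<^bsub>M\<^esub> a = \<one>\<^bsub>M\<^esub>"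
      unfolding Units_def by blast
    then show False using absorbing_mult ne by simp
  qed
  have units: "a \<otimes>\<^bsub>M\<^esub> b \<in> Units M \<longleftrightarrow> a \<in> Units M \<and> b \<in> Units M"
    if "a \<in> carrier M" "b \<in> carrier M" for a b
  proof
    assume "a \<otimes>\<^bsub>M\<^esub> b \<in> Units M"
    then obtain c where "c \<in> carrier M" "c \<otimes>\<^bsub>M\<^esub> (a \<otimes>\<^bsub>M\<^esub> b) = \<one>\<^bsub>M\<^esub>"
      unfolding Units_def by blast
    then have "(c \<otimes>\<^bsub>M\<^esub> a) \<otimes>\<^bsub>M\<^esub> b = \<one>\<^bsub>M\<^esub>" "(c \<otimes>\<^bsub>M\<^esub> b) \<otimes>\<^bsub>M\<^esub> a = \<one>\<^bsub>M\<^esub>"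
      using that by (simp_all add: m_ac)
    moreover have "u \<in> Units M"
      if "u \<in> carrier M" "v \<in> carrier M" "v \<otimes>\<^bsub>M\<^esub> u = \<one>\<^bsub>M\<^esub>" for u v
      using that m_comm[of u v] unfolding Units_def by auto
    ultimately show "a \<in> Units M \<and> b \<in> Units M"
      using that \<open>c \<in> carrier M\<close> m_closed by metis
  qed simp
  have val: "\<sigma> a \<in> insert None (Some ` carrier H)" "\<sigma> a \<in> Some ` carrier H \<longleftrightarrow> a \<in> Units M"
    if "local_mo_hom M (F1 H) \<sigma>" "a \<in> carrier M" for \<sigma> a
    using that unfolding local_mo_hom_def Units_F1[OF H] mo_hom_def hom_def
    by (auto simp: F1_def)
  show "\<forall>\<sigma>\<in>{\<sigma>. local_mo_hom M (F1 H) \<sigma>}.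
      (\<lambda>a\<in>carrier M. if a \<in> Units M then Some ((\<lambda>u\<in>Units M. the (\<sigma> u)) a) else None) = \<sigma>"
  proof (intro ballI ext)
    fix \<sigma> a assume s: "\<sigma> \<in> {\<sigma>. local_mo_hom M (F1 H) \<sigma>}"
    then have "\<sigma> \<in> extensional (carrier M)"
      unfolding local_mo_hom_def mo_hom_def by blast
    then show "(\<lambda>a\<in>carrier M. if a \<in> Units M then Some ((\<lambda>u\<in>Units M. the (\<sigma> u)) a) else None) a = \<sigma> a"
      using val[of \<sigma> a] s by (cases "a \<in> carrier M") (auto simp: extensional_def)
  qed
  show "\<forall>g\<in>ab_hom (units_of M) H.
      (\<lambda>u\<in>Units M. the ((\<lambda>a\<in>carrier M. if a \<in> Units M then Some (g a) else None) u)) = g"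
    unfolding ab_hom_def by (auto simp: extensional_def units_of_def fun_eq_iff)
  show "(\<lambda>\<sigma>. \<lambda>u\<in>Units M. the (\<sigma> u)) ` {\<sigma>. local_mo_hom M (F1 H) \<sigma>} \<subseteq> ab_hom (units_of M) H"
  proof clarify
    fix \<sigma> assume s: "local_mo_hom M (F1 H) \<sigma>"
    have "the (\<sigma> u) \<in> carrier H" if "u \<in> Units M" for u
      using val(2)[OF s Units_closed[OF that]] that by auto
    moreover have "the (\<sigma> (u \<otimes>\<^bsub>M\<^esub> v)) = the (\<sigma> u) \<otimes>\<^bsub>H\<^esub> the (\<sigma> v)"
      if uv: "u \<in> Units M" "v \<in> Units M" for u v
    proof -
      have "\<sigma> (u \<otimes>\<^bsub>M\<^esub> v) = \<sigma> u \<otimes>\<^bsub>F1 H\<^esub> \<sigma> v"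
        using s uv unfolding local_mo_hom_def mo_hom_def hom_def by auto
      then show ?thesis
        using val(2)[OF s Units_closed[OF uv(1)]] val(2)[OF s Units_closed[OF uv(2)]] uv
        by (auto simp: F1_def)
    qed
    ultimately show "(\<lambda>u\<in>Units M. the (\<sigma> u)) \<in> ab_hom (units_of M) H"
      unfolding ab_hom_def by (auto simp: hom_def units_of_def)
  qed
  show "(\<lambda>g. \<lambda>a\<in>carrier M. if a \<in> Units M then Some (g a) else None) ` ab_hom (units_of M) H
      \<subseteq> {\<sigma>. local_mo_hom M (F1 H) \<sigma>}"
  proof clarify
    fix g assume g: "g \<in> ab_hom (units_of M) H"
    then have cl: "\<And>u. u \<in> Units M \<Longrightarrow> g u \<in> carrier H"
      and mult: "\<And>u v. u \<in> Units M \<Longrightarrow> v \<in> Units M \<Longrightarrow> g (u \<otimes>\<^bsub>M\<^esub> v) = g u \<otimes>\<^bsub>H\<^esub> g v"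
      unfolding ab_hom_def hom_def units_of_def by auto
    \<comment> \<open>\<open>ab_hom\<close> asks for multiplicativity only; that 1 goes to 1 follows
      because g 1 is idempotent in the group H.\<close>
    have "g \<one>\<^bsub>M\<^esub> \<otimes>\<^bsub>H\<^esub> g \<one>\<^bsub>M\<^esub> = g \<one>\<^bsub>M\<^esub>"
      using mult[of "\<one>\<^bsub>M\<^esub>" "\<one>\<^bsub>M\<^esub>"] by simp
    then have "g \<one>\<^bsub>M\<^esub> = \<one>\<^bsub>H\<^esub>"
      using cl[of "\<one>\<^bsub>M\<^esub>"] H.l_cancel_one by blast
    then show "local_mo_hom M (F1 H) (\<lambda>a\<in>carrier M. if a \<in> Units M then Some (g a) else None)"
      unfolding local_mo_hom_def mo_hom_def Units_F1[OF H]
      using cl mult units zero absorbing_closed by (auto simp: hom_def F1_def)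
  qed
qed


section \<open>Open sets, sections and the stalk of the one-point spectrum\<close>

lemma openin_Spec_F1:
  assumes "comm_group H"
  shows "openin (gtop (Spec (F1 H))) U \<longleftrightarrow> U = {} \<or> U = {{None}}"
    and "topspace (gtop (Spec (F1 H))) = {{None}}"
proof -
  show top: "topspace (gtop (Spec (F1 H))) = {{None}}"
    using topspace_Spec_top[OF mo_monoid_F1[OF assms]] mo_prime_F1[OF assms]
    by (simp add: Spec_def)
  have "U = {} \<or> U = {{None}}" if "openin (gtop (Spec (F1 H))) U"
    using openin_subset[OF that] unfolding top by blast
  moreover have "openin (gtop (Spec (F1 H))) {{None}}"
    using openin_topspace[of "gtop (Spec (F1 H))"] unfolding top .
  ultimately show "openin (gtop (Spec (F1 H))) U \<longleftrightarrow> U = {} \<or> U = {{None}}"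
    by auto
qed

lemma gsec_Spec: "gsec (Spec M) = Spec_sec M"
  by (simp add: Spec_def)

lemma gres_Spec: "gres (Spec M) U V = (\<lambda>s\<in>carrier (Spec_sec M U). restrict s V)"
  by (simp add: Spec_def)

text \<open>An extensional function on the empty domain is \<open>undefined\<close> everywhere. This
  value reappears in \<open>F1_point\<close> as the section attached to an open set that misses the
  point.\<close>

lemma carrier_Spec_sec_empty: "carrier (Spec_sec M {}) = {\<lambda>_. undefined}"
  unfolding Spec_sec_def by auto

text \<open>The encoding of F1[H] as the monoid of global sections. Every denominator outside
  \<open>{None}\<close> is invertible, so each fraction has a unique form v/1.\<close>

definition F1_section :: "'h monoid \<Rightarrow> 'h option \<Rightarrow> 'h option set \<Rightarrow> ('h option \<times> 'h option) set"
  where "F1_section H v = (\<lambda>\<pp>\<in>{{None}}. frac (F1 H) (carrier (F1 H) - \<pp>) v \<one>\<^bsub>F1 H\<^esub>)"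

text \<open>A germ is the set of all its representatives. The only neighbourhood of the point is the
  whole space, so this set is a singleton.\<close>

definition F1_germ ::
    "'h monoid \<Rightarrow> 'h option \<Rightarrow> ('h option set set \<times> ('h option set \<Rightarrow> ('h option \<times> 'h option) set)) set"
  where "F1_germ H v = {({{None}}, F1_section H v)}"

text \<open>The assumptions are those of \<open>comm_group\<close>. A locale of its own gathers the
  facts about F1[G], to be combined with a geometric space in \<open>F1_points\<close> and
  instantiated at both H and K for naturality.\<close>

locale coefficient_group = comm_group G for G :: "'h monoid" (structure)
begin

lemma F1_denominators:
  "carrier (F1 G) - {None} \<subseteq> carrier (F1 G)" "\<one>\<^bsub>F1 G\<^esub> \<in> carrier (F1 G) - {None}"
  "a \<in> carrier (F1 G) - {None} \<Longrightarrow> b \<in> carrier (F1 G) - {None}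
    \<Longrightarrow> a \<otimes>\<^bsub>F1 G\<^esub> b \<in> carrier (F1 G) - {None}"
  by (auto simp: F1_def)

text \<open>A witness of v/1 = w/1 is an element of the group, hence cancels.\<close>

lemma frac_F1_eq_iff:
  assumes "v \<in> carrier (F1 G)" "w \<in> carrier (F1 G)"
  shows "frac (F1 G) (carrier (F1 G) - {None}) v \<one>\<^bsub>F1 G\<^esub> = frac (F1 G) (carrier (F1 G) - {None}) w \<one>\<^bsub>F1 G\<^esub>
    \<longleftrightarrow> v = w"
proof
  assume "frac (F1 G) (carrier (F1 G) - {None}) v \<one>\<^bsub>F1 G\<^esub> = frac (F1 G) (carrier (F1 G) - {None}) w \<one>\<^bsub>F1 G\<^esub>"
  then have "(v, \<one>\<^bsub>F1 G\<^esub>) \<in> frac (F1 G) (carrier (F1 G) - {None}) w \<one>\<^bsub>F1 G\<^esub>"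
    using frac_self[OF mo_monoid_F1[OF comm_group_axioms] F1_denominators(1,2) assms(1) F1_denominators(2)]
    by simp
  then show "v = w"
    using assms by (auto simp: frac_def F1_def)
qed simp

text \<open>The numerator v is the product of the inverse of f with a, and the identity f v = a
  gives a/f = v/1 with witness 1.\<close>

lemma frac_F1_normalize:
  assumes "a \<in> carrier (F1 G)" "f \<in> carrier (F1 G) - {None}"
  obtains v where "v \<in> carrier (F1 G)" "frac (F1 G) (carrier (F1 G) - {None}) a f
    = frac (F1 G) (carrier (F1 G) - {None}) v \<one>\<^bsub>F1 G\<^esub>"
proof -
  obtain g where g: "f = Some g" "g \<in> carrier G"
    using assms(2) by (auto simp: F1_def)
  let ?v = "Some (inv g) \<otimes>\<^bsub>F1 G\<^esub> a"
  have v: "?v \<in> carrier (F1 G)"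
    using assms g by (auto simp: F1_def)
  have fv: "f \<otimes>\<^bsub>F1 G\<^esub> ?v = a"
    using assms g by (auto simp: F1_def m_assoc[symmetric])
  have unit: "\<one>\<^bsub>F1 G\<^esub> \<otimes>\<^bsub>F1 G\<^esub> (\<one>\<^bsub>F1 G\<^esub> \<otimes>\<^bsub>F1 G\<^esub> a) = \<one>\<^bsub>F1 G\<^esub> \<otimes>\<^bsub>F1 G\<^esub> (f \<otimes>\<^bsub>F1 G\<^esub> ?v)"
    unfolding fv using assms(1) by (auto simp: F1_def)
  have "(?v, \<one>\<^bsub>F1 G\<^esub>) \<in> frac (F1 G) (carrier (F1 G) - {None}) a f"
    unfolding frac_def using v F1_denominators(2) unit by blast
  from frac_eqI[OF mo_monoid_F1[OF comm_group_axioms] F1_denominators assms this]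
  show thesis
    using that v by metis
qed

lemma carrier_loc_F1:
  "carrier (loc_at (F1 G) {None}) = (\<lambda>v. frac (F1 G) (carrier (F1 G) - {None}) v \<one>\<^bsub>F1 G\<^esub>) ` carrier (F1 G)"
proof (intro equalityI subsetI)
  fix c assume "c \<in> carrier (loc_at (F1 G) {None})"
  then show "c \<in> (\<lambda>v. frac (F1 G) (carrier (F1 G) - {None}) v \<one>\<^bsub>F1 G\<^esub>) ` carrier (F1 G)"
    by (auto simp: localization_def elim: frac_F1_normalize)
next
  fix c assume "c \<in> (\<lambda>v. frac (F1 G) (carrier (F1 G) - {None}) v \<one>\<^bsub>F1 G\<^esub>) ` carrier (F1 G)"
  then show "c \<in> carrier (loc_at (F1 G) {None})"
    using F1_denominators(2) by (auto simp: localization_def)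
qed

lemma carrier_Spec_sec_F1: "carrier (Spec_sec (F1 G) {{None}}) = F1_section G ` carrier (F1 G)"
proof (intro equalityI subsetI)
  fix s assume "s \<in> carrier (Spec_sec (F1 G) {{None}})"
  then have s: "s \<in> (\<Pi>\<^sub>E \<pp> \<in> {{None}}. carrier (loc_at (F1 G) \<pp>))"
    by (simp add: Spec_sec_def)
  then have "s {None} \<in> carrier (loc_at (F1 G) {None})"
    by (rule PiE_mem) simp
  then obtain v where v: "v \<in> carrier (F1 G)"
      "s {None} = frac (F1 G) (carrier (F1 G) - {None}) v \<one>\<^bsub>F1 G\<^esub>"
    unfolding carrier_loc_F1 by blast
  have "s = F1_section G v"
  proof
    show "s \<pp> = F1_section G v \<pp>" for \<pp>
      using s v(2) by (cases "\<pp> = {None}") (auto simp: F1_section_def PiE_def extensional_def)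
  qed
  then show "s \<in> F1_section G ` carrier (F1 G)"
    using v by blast
next
  fix s assume "s \<in> F1_section G ` carrier (F1 G)"
  then obtain v where v: "v \<in> carrier (F1 G)" "s = F1_section G v" by blast
  have "s \<in> (\<Pi>\<^sub>E \<pp> \<in> {{None}}. carrier (loc_at (F1 G) \<pp>))"
    using v carrier_loc_F1 by (auto simp: F1_section_def)
  moreover have "openin (Spec_top (F1 G)) {{None}}"
    using openin_Spec_F1(1)[OF comm_group_axioms] by (simp add: Spec_def)
  moreover have "\<one>\<^bsub>F1 G\<^esub> \<in> carrier (F1 G)" "\<one>\<^bsub>F1 G\<^esub> \<noteq> None"
    using F1_denominators(2) by auto
  \<comment> \<open>The neighbourhood on which the section is a single fraction is the whole
    space.\<close>
  ultimately show "s \<in> carrier (Spec_sec (F1 G) {{None}})"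
    using v unfolding Spec_sec_def by (auto simp: F1_section_def intro!: exI[of _ "{{None}}"])
qed

lemma F1_section_eq_iff:
  assumes "v \<in> carrier (F1 G)" "w \<in> carrier (F1 G)"
  shows "F1_section G v = F1_section G w \<longleftrightarrow> v = w"
proof
  assume "F1_section G v = F1_section G w"
  then have "F1_section G v {None} = F1_section G w {None}" by simp
  then show "v = w"
    using frac_F1_eq_iff[OF assms] by (simp add: F1_section_def)
qed simp

lemma F1_section_mult:
  assumes "v \<in> carrier (F1 G)" "w \<in> carrier (F1 G)"
  shows "F1_section G v \<otimes>\<^bsub>Spec_sec (F1 G) {{None}}\<^esub> F1_section G w = F1_section G (v \<otimes>\<^bsub>F1 G\<^esub> w)"
proof -
  interpret F: mo_monoid "F1 G" using mo_monoid_F1 comm_group_axioms .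
  show ?thesis
    using localization_mult_frac[OF F.mo_monoid_axioms F1_denominators
        assms(1) F1_denominators(2) assms(2) F1_denominators(2)]
    by (simp add: Spec_sec_def F1_section_def restrict_def fun_eq_iff)
qed

lemma F1_section_one: "F1_section G \<one>\<^bsub>F1 G\<^esub> = \<one>\<^bsub>Spec_sec (F1 G) {{None}}\<^esub>"
  by (auto simp: Spec_sec_def F1_section_def localization_def)

lemma F1_section_absorbing:
  "F1_section G (absorbing (F1 G)) = absorbing (Spec_sec (F1 G) {{None}})"
  by (auto simp: Spec_sec_def F1_section_def localization_def)

lemma nbhd_Spec_F1: "openin (gtop (Spec (F1 G))) U \<and> {None} \<in> U \<longleftrightarrow> U = {{None}}"
  using openin_Spec_F1(1)[OF comm_group_axioms, of U] by auto

lemma germ_Spec_F1: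
  assumes "s \<in> carrier (Spec_sec (F1 G) {{None}})"
  shows "germ (Spec (F1 G)) {None} {{None}} s = {({{None}}, s)}"
proof -
  have res: "gres (Spec (F1 G)) {{None}} {{None}} t = t" if "t \<in> carrier (Spec_sec (F1 G) {{None}})" for t
    using that by (auto simp: Spec_def Spec_sec_def PiE_def extensional_restrict)
  have "(V, t) \<in> germ (Spec (F1 G)) {None} {{None}} s \<longleftrightarrow> V = {{None}} \<and> t = s" for V t
  proof
    assume "(V, t) \<in> germ (Spec (F1 G)) {None} {{None}} s"
    then obtain W where "openin (gtop (Spec (F1 G))) V \<and> {None} \<in> V"
      "openin (gtop (Spec (F1 G))) W \<and> {None} \<in> W" "t \<in> carrier (Spec_sec (F1 G) V)"
      "gres (Spec (F1 G)) {{None}} W s = gres (Spec (F1 G)) V W t"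
      by (auto simp: germ_def gsec_Spec)
    then have "V = {{None}}" "W = {{None}}" "t \<in> carrier (Spec_sec (F1 G) V)"
      "gres (Spec (F1 G)) {{None}} W s = gres (Spec (F1 G)) V W t"
      unfolding nbhd_Spec_F1 by simp_all
    then show "V = {{None}} \<and> t = s"
      using res assms by metis
  next
    assume "V = {{None}} \<and> t = s"
    then show "(V, t) \<in> germ (Spec (F1 G)) {None} {{None}} s"
      unfolding germ_def gsec_Spec using nbhd_Spec_F1[of "{{None}}"] assms by auto
  qed
  then show ?thesis
    by auto
qed

lemma carrier_stalk_Spec_F1: "carrier (stalk (Spec (F1 G)) {None}) = F1_germ G ` carrier (F1 G)"
proof -
  have "carrier (stalk (Spec (F1 G)) {None})
      = (\<lambda>s. germ (Spec (F1 G)) {None} {{None}} s) ` carrier (Spec_sec (F1 G) {{None}})"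
  proof (intro equalityI subsetI)
    fix a assume "a \<in> carrier (stalk (Spec (F1 G)) {None})"
    then obtain U s where "openin (gtop (Spec (F1 G))) U \<and> {None} \<in> U"
      "s \<in> carrier (Spec_sec (F1 G) U)" "a = germ (Spec (F1 G)) {None} U s"
      by (auto simp: stalk_def gsec_Spec)
    then show "a \<in> (\<lambda>s. germ (Spec (F1 G)) {None} {{None}} s) ` carrier (Spec_sec (F1 G) {{None}})"
      unfolding nbhd_Spec_F1 by blast
  next
    fix a assume "a \<in> (\<lambda>s. germ (Spec (F1 G)) {None} {{None}} s) ` carrier (Spec_sec (F1 G) {{None}})"
    then show "a \<in> carrier (stalk (Spec (F1 G)) {None})"
      using nbhd_Spec_F1[of "{{None}}"] by (auto simp: stalk_def gsec_Spec)
  qed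
  also have "\<dots> = (\<lambda>s. {({{None}}, s)}) ` carrier (Spec_sec (F1 G) {{None}})"
    using germ_Spec_F1 by (rule image_cong[OF refl])
  finally show ?thesis
    by (auto simp: carrier_Spec_sec_F1 F1_germ_def)
qed

lemma stalk_Spec_F1_mult:
  assumes "v \<in> carrier (F1 G)" "w \<in> carrier (F1 G)"
  shows "F1_germ G v \<otimes>\<^bsub>stalk (Spec (F1 G)) {None}\<^esub> F1_germ G w = F1_germ G (v \<otimes>\<^bsub>F1 G\<^esub> w)"
proof -
  have c: "F1_section G u \<in> carrier (Spec_sec (F1 G) {{None}})" if "u \<in> carrier (F1 G)" for u
    using that carrier_Spec_sec_F1 by blast
  have res: "gres (Spec (F1 G)) {{None}} {{None}} (F1_section G u) = F1_section G u"
    if "u \<in> carrier (F1 G)" for u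
    using c[OF that] by (simp add: Spec_def F1_section_def)
  interpret F: mo_monoid "F1 G" using mo_monoid_F1 comm_group_axioms .
  show ?thesis
    using assms by (simp add: stalk_def gsec_Spec F1_germ_def res F1_section_mult germ_Spec_F1[OF c])
qed

lemma stalk_Spec_F1_one: "F1_germ G \<one>\<^bsub>F1 G\<^esub> = \<one>\<^bsub>stalk (Spec (F1 G)) {None}\<^esub>"
  and stalk_Spec_F1_absorbing: "F1_germ G (absorbing (F1 G)) = absorbing (stalk (Spec (F1 G)) {None})"
proof -
  interpret F: mo_monoid "F1 G" using mo_monoid_F1 comm_group_axioms .
  have c: "F1_section G u \<in> carrier (Spec_sec (F1 G) {{None}})" if "u \<in> carrier (F1 G)" for u
    using that carrier_Spec_sec_F1 by blast
  show "F1_germ G \<one>\<^bsub>F1 G\<^esub> = \<one>\<^bsub>stalk (Spec (F1 G)) {None}\<^esub>"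
    using germ_Spec_F1[OF c[OF F.one_closed]]
    by (simp add: stalk_def openin_Spec_F1[OF comm_group_axioms] gsec_Spec F1_germ_def F1_section_one)
  show "F1_germ G (absorbing (F1 G)) = absorbing (stalk (Spec (F1 G)) {None})"
    using germ_Spec_F1[OF c[OF F.absorbing_closed]]
    by (simp add: stalk_def openin_Spec_F1[OF comm_group_axioms] gsec_Spec F1_germ_def F1_section_absorbing)
qed

lemma F1_germ_eq_iff:
  "v \<in> carrier (F1 G) \<Longrightarrow> w \<in> carrier (F1 G) \<Longrightarrow> F1_germ G v = F1_germ G w \<longleftrightarrow> v = w"
  by (simp add: F1_germ_def F1_section_eq_iff)

text \<open>\<open>F1_germ\<close> is an isomorphism of monoids onto the stalk and so transports
  inverses. This allows locality to be tested in F1[G] instead of in the stalk.\<close>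

lemma F1_germ_Units:
  assumes v: "v \<in> carrier (F1 G)"
  shows "F1_germ G v \<in> Units (stalk (Spec (F1 G)) {None}) \<longleftrightarrow> v \<in> Units (F1 G)"
proof -
  interpret F: mo_monoid "F1 G" using mo_monoid_F1 comm_group_axioms .
  show ?thesis
    using v unfolding Units_def
    by (simp add: carrier_stalk_Spec_F1 stalk_Spec_F1_mult stalk_Spec_F1_one[symmetric] F1_germ_eq_iff)
qed

end


section \<open>Points with values in \<open>\<bbbF>\<^sub>1[H]\<close>\<close>

text \<open>The stalk map of f with its target decoded: \<open>inv_into\<close> undoes
  \<open>F1_germ\<close>, which is injective on the carrier.\<close>

definition stalk_val ::
    "'h monoid \<Rightarrow> ('p, 's) gspace \<Rightarrow> ('h option set, 'h option set \<Rightarrow> ('h option \<times> 'h option) set, 'p, 's) gs_map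
      \<Rightarrow> ('p set \<times> 's) set \<Rightarrow> 'h option" where
  "stalk_val H X f = (\<lambda>a\<in>carrier (stalk X (fst f {None})).
     inv_into (carrier (F1 H)) (F1_germ H) (stalk_map (Spec (F1 H)) X f {None} a))"

text \<open>If x is not in V, the preimage of V is empty and the \<open>undefined\<close> function
  is the only section over it. The restricted lambdas make both components extensional, as
  \<open>gs_hom\<close> demands.\<close>

definition F1_point ::
    "'h monoid \<Rightarrow> ('p, 's) gspace \<Rightarrow> 'p \<Rightarrow> (('p set \<times> 's) set \<Rightarrow> 'h option)
      \<Rightarrow> ('h option set, 'h option set \<Rightarrow> ('h option \<times> 'h option) set, 'p, 's) gs_map" where
  "F1_point H X x \<sigma> = (\<lambda>\<pp>\<in>{{None}}. x,
     \<lambda>V\<in>{V. openin (gtop X) V}. \<lambda>t\<in>carrier (gsec X V).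
       if x \<in> V then F1_section H (\<sigma> (germ X x V t)) else (\<lambda>_. undefined))"

locale F1_points = X: geometric_space X + H: coefficient_group H
  for X :: "('p, 's) gspace" and H :: "'h monoid"
begin

lemma comm_group_H: "comm_group H"
  by unfold_locales

sublocale F: mo_monoid "F1 H"
  using mo_monoid_F1 comm_group_H .

lemma inv_F1_germ: "v \<in> carrier (F1 H) \<Longrightarrow> inv_into (carrier (F1 H)) (F1_germ H) (F1_germ H v) = v"
  by (rule inv_into_f_f) (auto simp: inj_on_def H.F1_germ_eq_iff)

lemma preim_F1:
  "preim (Spec (F1 H)) f V = (if fst f {None} \<in> V then {{None}} else {})"
  by (auto simp: preim_def openin_Spec_F1(2)[OF comm_group_H])

lemma gres_F1: "s \<in> carrier (Spec_sec (F1 H) {{None}}) \<Longrightarrow> gres (Spec (F1 H)) {{None}} {{None}} s = s"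
  by (auto simp: Spec_def H.carrier_Spec_sec_F1 F1_section_def)

text \<open>The assumptions are the consequences of being a morphism that the computation uses. In
  this form the lemma applies to \<open>F1_point\<close> before it is known to be a morphism. By
  \<open>res\<close>, the value of f on a section does not change when its domain shrinks around x,
  so it depends on the germ alone.\<close>

lemma stalk_map_F1:
  assumes x: "fst f {None} = x"
    and sec: "\<And>V t. openin (gtop X) V \<Longrightarrow> x \<in> V \<Longrightarrow> t \<in> carrier (gsec X V)
      \<Longrightarrow> snd f V t \<in> carrier (Spec_sec (F1 H) {{None}})"
    and res: "\<And>V W t. openin (gtop X) V \<Longrightarrow> openin (gtop X) W \<Longrightarrow> W \<subseteq> V \<Longrightarrow> x \<in> W
      \<Longrightarrow> t \<in> carrier (gsec X V) \<Longrightarrow> snd f W (gres X V W t) = snd f V t"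
    and V: "openin (gtop X) V" "x \<in> V" "t \<in> carrier (gsec X V)"
  shows "stalk_map (Spec (F1 H)) X f {None} (germ X x V t) = {({{None}}, snd f V t)}"
proof -
  have eq: "germ (Spec (F1 H)) {None} (preim (Spec (F1 H)) f V') (snd f V' t') = {({{None}}, snd f V t)}"
    if g: "(V', t') \<in> germ X x V t" for V' t'
  proof -
    obtain W where W: "openin (gtop X) W" "x \<in> W" "W \<subseteq> V" "W \<subseteq> V'" "gres X V W t = gres X V' W t'"
      and V': "openin (gtop X) V'" "x \<in> V'" "t' \<in> carrier (gsec X V')"
      using g by (auto simp: germ_def)
    have "snd f V' t' = snd f V t"
      using res[OF V(1) W(1,3,2) V(3)] res[OF V'(1) W(1,4,2) V'(3)] W(5) by simp
    then show ?thesis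
      using H.germ_Spec_F1[OF sec[OF V]] x V'(2) by (simp add: preim_F1)
  qed
  have "(\<Union>(V', t') \<in> germ X x V t. germ (Spec (F1 H)) {None} (preim (Spec (F1 H)) f V') (snd f V' t'))
      = (\<Union>p \<in> germ X x V t. {({{None}}, snd f V t)})"
    by (rule SUP_cong[OF refl]) (auto simp: eq)
  also have "\<dots> = {({{None}}, snd f V t)}"
    using X.germ_self[OF V] by auto
  finally show ?thesis
    using X.germ_in_stalk[OF V] x by (simp add: stalk_map_def)
qed

lemma stalk_val_germ:
  assumes x: "fst f {None} = x"
    and sec: "\<And>V t. openin (gtop X) V \<Longrightarrow> x \<in> V \<Longrightarrow> t \<in> carrier (gsec X V)
      \<Longrightarrow> snd f V t \<in> carrier (Spec_sec (F1 H) {{None}})"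
    and res: "\<And>V W t. openin (gtop X) V \<Longrightarrow> openin (gtop X) W \<Longrightarrow> W \<subseteq> V \<Longrightarrow> x \<in> W
      \<Longrightarrow> t \<in> carrier (gsec X V) \<Longrightarrow> snd f W (gres X V W t) = snd f V t"
    and V: "openin (gtop X) V" "x \<in> V" "t \<in> carrier (gsec X V)"
    and v: "v \<in> carrier (F1 H)" "snd f V t = F1_section H v"
  shows "stalk_val H X f (germ X x V t) = v"
  using stalk_map_F1[OF x sec res V] X.germ_in_stalk[OF V] inv_F1_germ[OF v(1)] v(2) x
  by (simp add: stalk_val_def F1_germ_def)

text \<open>For a one-point source every preimage is \<open>{{None}}\<close> or empty. Hence
  restriction around x becomes the identity after pulling back, and the values over open sets
  missing x are forced.\<close>

lemma gs_homD:
  assumes f: "f \<in> gs_hom (Spec (F1 H)) X" and x: "fst f {None} = x"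
  shows "x \<in> topspace (gtop X)"
    and "openin (gtop X) V \<Longrightarrow> x \<in> V \<Longrightarrow> t \<in> carrier (gsec X V)
      \<Longrightarrow> snd f V t \<in> carrier (Spec_sec (F1 H) {{None}})"
    and "openin (gtop X) V \<Longrightarrow> x \<notin> V \<Longrightarrow> t \<in> carrier (gsec X V) \<Longrightarrow> snd f V t = (\<lambda>_. undefined)"
    and "openin (gtop X) V \<Longrightarrow> openin (gtop X) W \<Longrightarrow> W \<subseteq> V \<Longrightarrow> x \<in> W
      \<Longrightarrow> t \<in> carrier (gsec X V) \<Longrightarrow> snd f W (gres X V W t) = snd f V t"
    and "snd f \<in> extensional {V. openin (gtop X) V}"
    and "openin (gtop X) V \<Longrightarrow> snd f V \<in> extensional (carrier (gsec X V))"
    and "fst f \<in> extensional {{None}}"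
    and "local_mo_hom (stalk X x) (stalk (Spec (F1 H)) {None}) (stalk_map (Spec (F1 H)) X f {None})"
proof -
  have hom: "snd f V \<in> mo_hom (gsec X V) (Spec_sec (F1 H) (preim (Spec (F1 H)) f V))"
    if "openin (gtop X) V" for V
    using f that unfolding gs_hom_def gsec_Spec by blast
  have closed: "snd f V t \<in> carrier (Spec_sec (F1 H) (preim (Spec (F1 H)) f V))"
    if "openin (gtop X) V" "t \<in> carrier (gsec X V)" for V t
    using hom[OF that(1)] that(2) by (auto simp: mo_hom_def hom_def)
  show "x \<in> topspace (gtop X)"
    using f x unfolding gs_hom_def
    by (auto simp: continuous_map_def openin_Spec_F1(2)[OF comm_group_H])
  show sec: "snd f V t \<in> carrier (Spec_sec (F1 H) {{None}})"
    if "openin (gtop X) V" "x \<in> V" "t \<in> carrier (gsec X V)" for V t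
    using closed[OF that(1,3)] that(2) x by (simp add: preim_F1)
  show "snd f V t = (\<lambda>_. undefined)"
    if "openin (gtop X) V" "x \<notin> V" "t \<in> carrier (gsec X V)"
    using closed[OF that(1,3)] that(2) x by (simp add: preim_F1 carrier_Spec_sec_empty)
  show "snd f W (gres X V W t) = snd f V t"
    if V: "openin (gtop X) V" and W: "openin (gtop X) W" "W \<subseteq> V" "x \<in> W" and t: "t \<in> carrier (gsec X V)"
  proof -
    have "snd f W (gres X V W t)
        = gres (Spec (F1 H)) (preim (Spec (F1 H)) f V) (preim (Spec (F1 H)) f W) (snd f V t)"
      using f V W(1,2) t unfolding gs_hom_def by blast
    moreover have "x \<in> V" using W by blast
    ultimately show ?thesis
      using W(3) x gres_F1[OF sec[OF V _ t]] by (simp add: preim_F1)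
  qed
  show "snd f \<in> extensional {V. openin (gtop X) V}"
    using f unfolding gs_hom_def PiE_def by blast
  show "snd f V \<in> extensional (carrier (gsec X V))" if "openin (gtop X) V"
    using hom[OF that] unfolding mo_hom_def by blast
  show "fst f \<in> extensional {{None}}"
    using f openin_Spec_F1(2)[OF comm_group_H] unfolding gs_hom_def by auto
  show "local_mo_hom (stalk X x) (stalk (Spec (F1 H)) {None}) (stalk_map (Spec (F1 H)) X f {None})"
    using f x openin_Spec_F1(2)[OF comm_group_H] unfolding gs_hom_def by auto
qed

lemma local_mo_hom_stalk_val:
  assumes f: "f \<in> gs_hom (Spec (F1 H)) X"
  shows "local_mo_hom (stalk X (fst f {None})) (F1 H) (stalk_val H X f)"
proof -
  define S where "S = stalk X (fst f {None})"
  define \<tau> where "\<tau> = stalk_map (Spec (F1 H)) X f {None}"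
  define \<sigma> where "\<sigma> = stalk_val H X f"
  interpret S: mo_monoid S
    unfolding S_def using X.mo_monoid_stalk gs_homD(1)[OF f refl] .
  have loc: "local_mo_hom S (stalk (Spec (F1 H)) {None}) \<tau>"
    unfolding S_def \<tau>_def using gs_homD(8)[OF f refl] .
  then have \<tau>: "\<tau> \<in> carrier S \<rightarrow> F1_germ H ` carrier (F1 H)"
      "\<tau> \<one>\<^bsub>S\<^esub> = F1_germ H \<one>\<^bsub>F1 H\<^esub>" "\<tau> (absorbing S) = F1_germ H (absorbing (F1 H))"
    and units: "\<And>a. a \<in> carrier S \<Longrightarrow> \<tau> a \<in> Units (stalk (Spec (F1 H)) {None}) \<longleftrightarrow> a \<in> Units S"
    unfolding local_mo_hom_def mo_hom_def hom_def H.carrier_stalk_Spec_F1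
      H.stalk_Spec_F1_one H.stalk_Spec_F1_absorbing by auto
  have mult: "\<tau> (a \<otimes>\<^bsub>S\<^esub> b) = \<tau> a \<otimes>\<^bsub>stalk (Spec (F1 H)) {None}\<^esub> \<tau> b"
    if "a \<in> carrier S" "b \<in> carrier S" for a b
    using loc that unfolding local_mo_hom_def mo_hom_def hom_def by blast
  \<comment> \<open>The stalk map factors as \<open>F1_germ\<close> after \<open>\<sigma>\<close>.
    What remains is to cancel the injective \<open>F1_germ\<close> in each law.\<close>
  have \<sigma>: "\<sigma> a \<in> carrier (F1 H)" "\<tau> a = F1_germ H (\<sigma> a)" if a: "a \<in> carrier S" for a
  proof -
    obtain v where v: "v \<in> carrier (F1 H)" "\<tau> a = F1_germ H v"
      using \<tau>(1) a by blast
    then have "\<sigma> a = v"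
      using a inv_F1_germ[OF v(1)] unfolding \<sigma>_def \<tau>_def S_def stalk_val_def by simp
    then show "\<sigma> a \<in> carrier (F1 H)" "\<tau> a = F1_germ H (\<sigma> a)"
      using v by simp_all
  qed
  have "\<sigma> \<one>\<^bsub>S\<^esub> = \<one>\<^bsub>F1 H\<^esub>" "\<sigma> (absorbing S) = absorbing (F1 H)"
    using \<tau>(2,3) \<sigma>[OF S.one_closed] \<sigma>[OF S.absorbing_closed]
      H.F1_germ_eq_iff F.one_closed F.absorbing_closed by simp_all
  moreover have "\<sigma> (a \<otimes>\<^bsub>S\<^esub> b) = \<sigma> a \<otimes>\<^bsub>F1 H\<^esub> \<sigma> b" if ab: "a \<in> carrier S" "b \<in> carrier S" for a b
  proof -
    have "F1_germ H (\<sigma> (a \<otimes>\<^bsub>S\<^esub> b)) = F1_germ H (\<sigma> a \<otimes>\<^bsub>F1 H\<^esub> \<sigma> b)"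
      using mult[OF ab] \<sigma>(2)[OF S.m_closed[OF ab]] \<sigma>(2)[OF ab(1)] \<sigma>(2)[OF ab(2)]
        H.stalk_Spec_F1_mult[OF \<sigma>(1)[OF ab(1)] \<sigma>(1)[OF ab(2)]] by simp
    then show ?thesis
      using H.F1_germ_eq_iff \<sigma>(1) ab S.m_closed F.m_closed by simp
  qed
  moreover have "\<sigma> \<in> extensional (carrier S)"
    unfolding \<sigma>_def S_def stalk_val_def by simp
  moreover have "\<sigma> a \<in> Units (F1 H) \<longleftrightarrow> a \<in> Units S" if "a \<in> carrier S" for a
    using units[OF that] H.F1_germ_Units[OF \<sigma>(1)[OF that]] \<sigma>(2)[OF that] by simp
  ultimately have "local_mo_hom S (F1 H) \<sigma>"
    using \<sigma>(1) S.Units_closed unfolding local_mo_hom_def mo_hom_def hom_def by auto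
  then show ?thesis
    unfolding S_def \<sigma>_def .
qed

text \<open>Passing to germs at the only point of the spectrum forgets nothing, so the stalk value
  recovers the section maps over all neighbourhoods of x.\<close>

lemma F1_section_stalk_val:
  assumes f: "f \<in> gs_hom (Spec (F1 H)) X" and x: "fst f {None} = x"
    and V: "openin (gtop X) V" "x \<in> V" "t \<in> carrier (gsec X V)"
  shows "F1_section H (stalk_val H X f (germ X x V t)) = snd f V t"
proof -
  obtain v where v: "v \<in> carrier (F1 H)" "snd f V t = F1_section H v"
    using gs_homD(2)[OF f x V] H.carrier_Spec_sec_F1 by blast
  then show ?thesis
    using stalk_val_germ[OF x gs_homD(2)[OF f x] gs_homD(4)[OF f x] V v] by simp
qed

lemma F1_point_stalk_val:
  assumes f: "f \<in> gs_hom (Spec (F1 H)) X"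
  shows "F1_point H X (fst f {None}) (stalk_val H X f) = f"
proof (rule prod_eqI)
  note D = gs_homD[OF f refl]
  show "fst (F1_point H X (fst f {None}) (stalk_val H X f)) = fst f"
    using D(7) by (auto simp: F1_point_def extensional_def fun_eq_iff)
  show "snd (F1_point H X (fst f {None}) (stalk_val H X f)) = snd f"
  proof (rule ext, rule ext)
    fix V t
    show "snd (F1_point H X (fst f {None}) (stalk_val H X f)) V t = snd f V t"
    proof (cases "openin (gtop X) V \<and> t \<in> carrier (gsec X V)")
      case True
      then show ?thesis
        using D(3)[of V t] F1_section_stalk_val[OF f refl, of V t] by (simp add: F1_point_def)
    next
      \<comment> \<open>Off their domains both maps are \<open>undefined\<close>, by
        extensionality.\<close>
      case False
      then show ?thesis
        using D(5) D(6)[of V] by (cases "openin (gtop X) V") (auto simp: F1_point_def extensional_def)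
    qed
  qed
qed

text \<open>Supplies the assumptions of \<open>stalk_map_F1\<close> and
  \<open>stalk_val_germ\<close> for \<open>F1_point\<close>. Compatibility with restriction holds
  because the section maps depend on germs only.\<close>

lemma F1_point_sections:
  assumes x: "x \<in> topspace (gtop X)" and \<sigma>: "local_mo_hom (stalk X x) (F1 H) \<sigma>"
  shows "fst (F1_point H X x \<sigma>) {None} = x"
    and "openin (gtop X) V \<Longrightarrow> x \<in> V \<Longrightarrow> t \<in> carrier (gsec X V)
      \<Longrightarrow> \<sigma> (germ X x V t) \<in> carrier (F1 H) \<and> snd (F1_point H X x \<sigma>) V t = F1_section H (\<sigma> (germ X x V t))"
    and "openin (gtop X) V \<Longrightarrow> x \<in> V \<Longrightarrow> t \<in> carrier (gsec X V)
      \<Longrightarrow> snd (F1_point H X x \<sigma>) V t \<in> carrier (Spec_sec (F1 H) {{None}})"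
    and "openin (gtop X) V \<Longrightarrow> openin (gtop X) W \<Longrightarrow> W \<subseteq> V \<Longrightarrow> x \<in> W \<Longrightarrow> t \<in> carrier (gsec X V)
      \<Longrightarrow> snd (F1_point H X x \<sigma>) W (gres X V W t) = snd (F1_point H X x \<sigma>) V t"
proof -
  show "fst (F1_point H X x \<sigma>) {None} = x"
    by (simp add: F1_point_def)
  have cl: "\<sigma> (germ X x V t) \<in> carrier (F1 H)"
    if "openin (gtop X) V" "x \<in> V" "t \<in> carrier (gsec X V)" for V t
    using X.germ_in_stalk[OF that] \<sigma> unfolding local_mo_hom_def mo_hom_def hom_def by blast
  show *: "\<sigma> (germ X x V t) \<in> carrier (F1 H) \<and> snd (F1_point H X x \<sigma>) V t = F1_section H (\<sigma> (germ X x V t))"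
    if "openin (gtop X) V" "x \<in> V" "t \<in> carrier (gsec X V)" for V t
    using that cl[OF that] by (simp add: F1_point_def)
  show "snd (F1_point H X x \<sigma>) V t \<in> carrier (Spec_sec (F1 H) {{None}})"
    if "openin (gtop X) V" "x \<in> V" "t \<in> carrier (gsec X V)"
    using *[OF that] H.carrier_Spec_sec_F1 by blast
  show "snd (F1_point H X x \<sigma>) W (gres X V W t) = snd (F1_point H X x \<sigma>) V t"
    if V: "openin (gtop X) V" "openin (gtop X) W" "W \<subseteq> V" "x \<in> W" "t \<in> carrier (gsec X V)"
  proof -
    have "x \<in> V" using V by blast
    then show ?thesis
      using *[OF V(1) _ V(5)] *[OF V(2,4) X.res_closed[OF V(1,2,3,5)]] X.germ_res[OF V] by simp
  qed
qed

lemma stalk_val_F1_point: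
  assumes x: "x \<in> topspace (gtop X)" and \<sigma>: "local_mo_hom (stalk X x) (F1 H) \<sigma>"
  shows "stalk_val H X (F1_point H X x \<sigma>) = \<sigma>"
proof
  note P = F1_point_sections[OF x \<sigma>]
  fix a
  show "stalk_val H X (F1_point H X x \<sigma>) a = \<sigma> a"
  proof (cases "a \<in> carrier (stalk X x)")
    case True
    then obtain V t where V: "openin (gtop X) V" "x \<in> V" "t \<in> carrier (gsec X V)" "a = germ X x V t"
      by (rule X.stalkE)
    then show ?thesis
      using stalk_val_germ[OF P(1) P(3) P(4) V(1,2,3)] P(2)[OF V(1,2,3)] by blast
  next
    case False
    moreover have "\<sigma> \<in> extensional (carrier (stalk X x))"
      using \<sigma> unfolding local_mo_hom_def mo_hom_def by blast
    ultimately show ?thesis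
      by (simp add: stalk_val_def P(1) extensional_def)
  qed
qed

text \<open>Over a neighbourhood of x the section map is the germ map, then \<open>\<sigma>\<close>,
  then \<open>F1_section\<close>, each of them compatible with products, 1 and 0. On stalks this
  becomes \<open>F1_germ\<close> after \<open>\<sigma>\<close>, so the stalk map inherits locality
  from \<open>\<sigma>\<close>.\<close>

lemma F1_point_gs_hom:
  assumes x: "x \<in> topspace (gtop X)" and \<sigma>: "local_mo_hom (stalk X x) (F1 H) \<sigma>"
  shows "F1_point H X x \<sigma> \<in> gs_hom (Spec (F1 H)) X"
proof -
  note P = F1_point_sections[OF x \<sigma>]
  define f where "f = F1_point H X x \<sigma>"
  have fst: "fst f = (\<lambda>\<pp>\<in>{{None}}. x)"
    by (simp add: f_def F1_point_def)
  have pre: "preim (Spec (F1 H)) f V = (if x \<in> V then {{None}} else {})" for V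
    by (simp add: preim_F1 fst)
  have "continuous_map (gtop (Spec (F1 H))) (gtop X) (fst f)"
    unfolding continuous_map_def openin_Spec_F1[OF comm_group_H]
    using x by (auto simp: fst)
  moreover have "fst f \<in> extensional (topspace (gtop (Spec (F1 H))))"
    unfolding openin_Spec_F1[OF comm_group_H] by (simp add: fst)
  moreover have "snd f \<in> (\<Pi>\<^sub>E V \<in> {V. openin (gtop X) V}.
      mo_hom (gsec X V) (gsec (Spec (F1 H)) (preim (Spec (F1 H)) f V)))"
  proof (rule PiE_I)
    fix V assume "V \<in> {V. openin (gtop X) V}"
    then have V: "openin (gtop X) V" by simp
    interpret V: mo_monoid "gsec X V" using X.sec_monoid V .
    have ext: "snd f V \<in> extensional (carrier (gsec X V))"
      using V by (simp add: f_def F1_point_def)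
    show "snd f V \<in> mo_hom (gsec X V) (gsec (Spec (F1 H)) (preim (Spec (F1 H)) f V))"
    proof (cases "x \<in> V")
      case True
      note P2 = P(2)[OF V True, folded f_def]
      have h: "\<sigma> \<in> hom (stalk X x) (F1 H)" "\<sigma> \<one>\<^bsub>stalk X x\<^esub> = \<one>\<^bsub>F1 H\<^esub>"
          "\<sigma> (absorbing (stalk X x)) = absorbing (F1 H)"
        using \<sigma> unfolding local_mo_hom_def mo_hom_def by auto
      have "snd f V (s \<otimes>\<^bsub>gsec X V\<^esub> t) = snd f V s \<otimes>\<^bsub>Spec_sec (F1 H) {{None}}\<^esub> snd f V t"
        if st: "s \<in> carrier (gsec X V)" "t \<in> carrier (gsec X V)" for s t
      proof -
        have "\<sigma> (germ X x V (s \<otimes>\<^bsub>gsec X V\<^esub> t)) = \<sigma> (germ X x V s) \<otimes>\<^bsub>F1 H\<^esub> \<sigma> (germ X x V t)"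
          using hom_mult[OF h(1)] X.germ_in_stalk[OF V True] X.stalk_mult_germ[OF V True] st by metis
        then show ?thesis
          using P2[OF st(1)] P2[OF st(2)] P2[OF V.m_closed[OF st]] H.F1_section_mult by simp
      qed
      moreover have "snd f V \<one>\<^bsub>gsec X V\<^esub> = \<one>\<^bsub>Spec_sec (F1 H) {{None}}\<^esub>"
        using P2[OF V.one_closed] h(2) X.stalk_one_germ[OF V True] H.F1_section_one by simp
      moreover have "snd f V (absorbing (gsec X V)) = absorbing (Spec_sec (F1 H) {{None}})"
        using P2[OF V.absorbing_closed] h(3) X.stalk_absorbing_germ[OF V True] H.F1_section_absorbing
        by simp
      moreover have "snd f V s \<in> carrier (Spec_sec (F1 H) {{None}})" if "s \<in> carrier (gsec X V)" for s
        using P(3)[OF V True that] unfolding f_def .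
      ultimately show ?thesis
        using True ext by (simp add: pre gsec_Spec mo_hom_def hom_def)
    next
      \<comment> \<open>The target is the section monoid of the empty set. It has one element, so
        every law holds.\<close>
      case False
      then have "snd f V s = (\<lambda>_. undefined)" if "s \<in> carrier (gsec X V)" for s
        using V that by (simp add: f_def F1_point_def)
      then show ?thesis
        using False ext V.absorbing_closed
        by (auto simp: pre gsec_Spec mo_hom_def hom_def carrier_Spec_sec_empty)
          (auto simp: Spec_sec_def)
    qed
  next
    fix V assume "V \<notin> {V. openin (gtop X) V}"
    then show "snd f V = undefined"
      by (simp add: f_def F1_point_def)
  qed
  moreover have "snd f W (gres X V W t)
      = gres (Spec (F1 H)) (preim (Spec (F1 H)) f V) (preim (Spec (F1 H)) f W) (snd f V t)"
    if V: "openin (gtop X) V" "openin (gtop X) W" "W \<subseteq> V" and t: "t \<in> carrier (gsec X V)" for V W t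
  proof (cases "x \<in> W")
    case True
    then have "x \<in> V" using V by blast
    then show ?thesis
      using P(4)[OF V True t, folded f_def] gres_F1[OF P(3)[OF V(1) _ t, folded f_def]] True
      by (simp add: pre)
  next
    case False
    then have "snd f W (gres X V W t) = (\<lambda>_. undefined)"
      using V X.res_closed[OF V t] by (simp add: f_def F1_point_def)
    \<comment> \<open>V may still contain x. Since \<open>gres\<close> is cut down to actual
      sections, membership is needed before it can be evaluated as restriction to the empty
      set.\<close>
    moreover have "snd f V t \<in> carrier (Spec_sec (F1 H) (preim (Spec (F1 H)) f V))"
      unfolding pre using P(3)[OF V(1) _ t] V(1) t
      by (auto simp: f_def carrier_Spec_sec_empty F1_point_def)
    ultimately show ?thesis
      using False by (simp add: pre gres_Spec restrict_def)
  qed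
  moreover have "local_mo_hom (stalk X x) (stalk (Spec (F1 H)) {None}) (stalk_map (Spec (F1 H)) X f {None})"
  proof -
    define \<tau> where "\<tau> = stalk_map (Spec (F1 H)) X f {None}"
    interpret S: mo_monoid "stalk X x" using X.mo_monoid_stalk x .
    have \<tau>: "\<tau> a = F1_germ H (\<sigma> a)" "\<sigma> a \<in> carrier (F1 H)" if a: "a \<in> carrier (stalk X x)" for a
    proof -
      obtain V t where V: "openin (gtop X) V" "x \<in> V" "t \<in> carrier (gsec X V)" "a = germ X x V t"
        using a by (rule X.stalkE)
      then show "\<tau> a = F1_germ H (\<sigma> a)" "\<sigma> a \<in> carrier (F1 H)"
        using stalk_map_F1[OF P(1) P(3) P(4) V(1,2,3)] P(2)[OF V(1,2,3)]
        by (simp_all add: \<tau>_def f_def F1_germ_def)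
    qed
    have ext: "\<tau> \<in> extensional (carrier (stalk X x))"
      by (simp add: \<tau>_def stalk_map_def fst)
    have \<sigma>_hom: "\<sigma> (a \<otimes>\<^bsub>stalk X x\<^esub> b) = \<sigma> a \<otimes>\<^bsub>F1 H\<^esub> \<sigma> b"
      if "a \<in> carrier (stalk X x)" "b \<in> carrier (stalk X x)" for a b
      using \<sigma> that unfolding local_mo_hom_def mo_hom_def hom_def by blast
    have \<sigma>_units: "\<sigma> a \<in> Units (F1 H) \<longleftrightarrow> a \<in> Units (stalk X x)" if "a \<in> carrier (stalk X x)" for a
      using \<sigma> that unfolding local_mo_hom_def by blast
    have \<sigma>_one: "\<sigma> \<one>\<^bsub>stalk X x\<^esub> = \<one>\<^bsub>F1 H\<^esub>" "\<sigma> (absorbing (stalk X x)) = absorbing (F1 H)"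
      using \<sigma> unfolding local_mo_hom_def mo_hom_def by auto
    have "\<tau> \<in> mo_hom (stalk X x) (stalk (Spec (F1 H)) {None})"
      using ext \<tau> \<sigma>_hom \<sigma>_one S.absorbing_closed
      by (auto simp: mo_hom_def hom_def H.carrier_stalk_Spec_F1 H.stalk_Spec_F1_mult
          H.stalk_Spec_F1_one H.stalk_Spec_F1_absorbing)
    moreover have "{a \<in> carrier (stalk X x). \<tau> a \<in> Units (stalk (Spec (F1 H)) {None})} = Units (stalk X x)"
      using \<tau> \<sigma>_units H.F1_germ_Units S.Units_closed by auto
    ultimately show ?thesis
      unfolding local_mo_hom_def \<tau>_def by blast
  qed
  ultimately have "f \<in> gs_hom (Spec (F1 H)) X"
    unfolding gs_hom_def openin_Spec_F1(2)[OF comm_group_H] by (simp add: fst)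
  then show ?thesis
    unfolding f_def .
qed

lemma bij_betw_gs_hom_local_mo_hom:
  "bij_betw (\<lambda>f. (fst f {None}, stalk_val H X f)) (gs_hom (Spec (F1 H)) X)
    (SIGMA x:topspace (gtop X). {\<sigma>. local_mo_hom (stalk X x) (F1 H) \<sigma>})"
proof (rule bij_betw_byWitness[where f' = "\<lambda>(x, \<sigma>). F1_point H X x \<sigma>"])
  show "(\<lambda>f. (fst f {None}, stalk_val H X f)) ` gs_hom (Spec (F1 H)) X
      \<subseteq> (SIGMA x:topspace (gtop X). {\<sigma>. local_mo_hom (stalk X x) (F1 H) \<sigma>})"
    using gs_homD(1) local_mo_hom_stalk_val by blast
qed (auto simp: F1_point_stalk_val stalk_val_F1_point F1_point_sections(1) F1_point_gs_hom)

end

section \<open>Functoriality in the coefficient group\<close>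

lemma frac_map:
  assumes "\<rho> \<in> mo_hom M N" "S \<subseteq> carrier M" "\<rho> ` S \<subseteq> T" "a \<in> carrier M" "f \<in> S"
    and "(b, g) \<in> frac M S a f" and "mo_monoid M"
  shows "(\<rho> b, \<rho> g) \<in> frac N T (\<rho> a) (\<rho> f)"
proof -
  interpret mo_monoid M by fact
  have \<rho>: "\<rho> \<in> hom M N" using assms(1) unfolding mo_hom_def by blast
  obtain h where h: "b \<in> carrier M" "g \<in> S" "h \<in> S"
    "h \<otimes>\<^bsub>M\<^esub> (g \<otimes>\<^bsub>M\<^esub> a) = h \<otimes>\<^bsub>M\<^esub> (f \<otimes>\<^bsub>M\<^esub> b)"
    using assms(6) by (auto simp: frac_def)
  have cl: "g \<in> carrier M" "h \<in> carrier M" "f \<in> carrier M"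
    using h assms by auto
  have "\<rho> h \<otimes>\<^bsub>N\<^esub> (\<rho> g \<otimes>\<^bsub>N\<^esub> \<rho> a) = \<rho> (h \<otimes>\<^bsub>M\<^esub> (g \<otimes>\<^bsub>M\<^esub> a))"
    using cl assms(4) by (simp add: hom_mult[OF \<rho>])
  also have "\<dots> = \<rho> h \<otimes>\<^bsub>N\<^esub> (\<rho> f \<otimes>\<^bsub>N\<^esub> \<rho> b)"
    unfolding h(4) using cl h(1) by (simp add: hom_mult[OF \<rho>])
  finally show ?thesis
    using h assms(3) hom_in_carrier[OF \<rho> h(1)] by (auto simp: frac_def)
qed

text \<open>Group elements never go to \<open>None\<close>, so the inverse image of the prime
  \<open>{None}\<close> is again \<open>{None}\<close>. The union over representatives in
  \<open>Spec_map\<close> is constant because \<open>frac_map\<close> sends every representative of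
  v/1 into the class of the image of v over 1.\<close>

lemma Spec_map_F1:
  assumes H: "comm_group H" and K: "comm_group K" and h: "h \<in> ab_hom H K"
  shows "fst (Spec_map (F1 H) (F1 K) (F1_map H h)) {None} = {None}"
    and "v \<in> carrier (F1 H) \<Longrightarrow>
      snd (Spec_map (F1 H) (F1 K) (F1_map H h)) {{None}} (F1_section H v) = F1_section K (F1_map H h v)"
proof -
  define \<rho> where "\<rho> = F1_map H h"
  interpret H: coefficient_group H using H by (simp add: coefficient_group_def)
  interpret K: coefficient_group K using K by (simp add: coefficient_group_def)
  interpret FH: mo_monoid "F1 H" using mo_monoid_F1 H .
  interpret FK: mo_monoid "F1 K" using mo_monoid_F1 K .
  have \<rho>: "\<rho> \<in> mo_hom (F1 H) (F1 K)"
    unfolding \<rho>_def using F1_map_mo_hom assms by blast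
  have inv_im: "{a \<in> carrier (F1 H). \<rho> a \<in> {None}} = {None}"
    by (auto simp: \<rho>_def F1_map_def F1_def)
  show "fst (Spec_map (F1 H) (F1 K) (F1_map H h)) {None} = {None}"
    using inv_im unfolding Spec_map_def Let_def \<rho>_def by (simp add: mo_prime_F1[OF K])
  assume v: "v \<in> carrier (F1 H)"
  have denominators: "\<rho> ` (carrier (F1 H) - {None}) \<subseteq> carrier (F1 K) - {None}"
    using \<rho> inv_im unfolding mo_hom_def hom_def by auto
  have one: "\<rho> \<one>\<^bsub>F1 H\<^esub> = \<one>\<^bsub>F1 K\<^esub>" and \<rho>v: "\<rho> v \<in> carrier (F1 K)"
    using \<rho> v unfolding mo_hom_def hom_def by auto
  let ?SH = "carrier (F1 H) - {None}" and ?SK = "carrier (F1 K) - {None}"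
  have eq: "frac (F1 K) ?SK (\<rho> a) (\<rho> f) = frac (F1 K) ?SK (\<rho> v) \<one>\<^bsub>F1 K\<^esub>"
    if "(a, f) \<in> frac (F1 H) ?SH v \<one>\<^bsub>F1 H\<^esub>" for a f
    using frac_map[OF \<rho> H.F1_denominators(1) denominators v H.F1_denominators(2) that FH.mo_monoid_axioms]
    unfolding one
    by (intro frac_eqI[OF FK.mo_monoid_axioms K.F1_denominators \<rho>v K.F1_denominators(2)])
  have "(\<Union>(a, f) \<in> frac (F1 H) ?SH v \<one>\<^bsub>F1 H\<^esub>. frac (F1 K) ?SK (\<rho> a) (\<rho> f))
      = (\<Union>p \<in> frac (F1 H) ?SH v \<one>\<^bsub>F1 H\<^esub>. frac (F1 K) ?SK (\<rho> v) \<one>\<^bsub>F1 K\<^esub>)"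
    by (rule SUP_cong[OF refl]) (auto simp: eq)
  also have "\<dots> = frac (F1 K) ?SK (\<rho> v) \<one>\<^bsub>F1 K\<^esub>"
    using frac_self[OF FH.mo_monoid_axioms H.F1_denominators(1,2) v H.F1_denominators(2)] by auto
  finally have union: "(\<Union>(a, f) \<in> frac (F1 H) ?SH v \<one>\<^bsub>F1 H\<^esub>. frac (F1 K) ?SK (\<rho> a) (\<rho> f))
      = frac (F1 K) ?SK (\<rho> v) \<one>\<^bsub>F1 K\<^esub>" .
  have "openin (Spec_top (F1 H)) {{None}}" "F1_section H v \<in> carrier (Spec_sec (F1 H) {{None}})"
    using openin_Spec_F1(1)[OF H] v H.carrier_Spec_sec_F1 by (simp_all add: Spec_def)
  then have "snd (Spec_map (F1 H) (F1 K) \<rho>) {{None}} (F1_section H v)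
      = (\<lambda>\<pp>\<in>{\<pp>. mo_prime (F1 K) \<pp> \<and> {a \<in> carrier (F1 H). \<rho> a \<in> \<pp>} \<in> {{None}}}.
          \<Union>(a, f) \<in> F1_section H v {a \<in> carrier (F1 H). \<rho> a \<in> \<pp>}. frac (F1 K) (carrier (F1 K) - \<pp>) (\<rho> a) (\<rho> f))"
    unfolding Spec_map_def Let_def by simp
  also have "\<dots> = F1_section K (\<rho> v)"
  proof
    fix \<pp>
    show "(\<lambda>\<pp>\<in>{\<pp>. mo_prime (F1 K) \<pp> \<and> {a \<in> carrier (F1 H). \<rho> a \<in> \<pp>} \<in> {{None}}}.
          \<Union>(a, f) \<in> F1_section H v {a \<in> carrier (F1 H). \<rho> a \<in> \<pp>}. frac (F1 K) (carrier (F1 K) - \<pp>) (\<rho> a) (\<rho> f)) \<pp>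
        = F1_section K (\<rho> v) \<pp>"
      using inv_im union by (cases "\<pp> = {None}") (simp_all add: F1_section_def mo_prime_F1[OF K])
  qed
  finally show "snd (Spec_map (F1 H) (F1 K) (F1_map H h)) {{None}} (F1_section H v) = F1_section K (F1_map H h v)"
    unfolding \<rho>_def .
qed

text \<open>Naturality in H at the level of stalk values. The value of the composite is read off its
  section maps by \<open>stalk_val_germ\<close>, which asks for \<open>sec\<close> and
  \<open>res\<close> rather than for membership in \<open>gs_hom\<close>.\<close>

lemma stalk_val_gs_comp:
  assumes X: "geometric_space X" and H: "comm_group H" and K: "comm_group K" and h: "h \<in> ab_hom H K"
    and f: "f \<in> gs_hom (Spec (F1 H)) X"
    and g: "g = gs_comp (Spec (F1 K)) (Spec (F1 H)) X f (Spec_map (F1 H) (F1 K) (F1_map H h))"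
    and a: "a \<in> carrier (stalk X (fst f {None}))"
  shows "stalk_val K X g a = F1_map H h (stalk_val H X f a)" and "fst g {None} = fst f {None}"
proof -
  interpret H: F1_points X H
    using X H by (simp add: F1_points_def coefficient_group_def)
  interpret K: F1_points X K
    using X K by (simp add: F1_points_def coefficient_group_def)
  define x where "x = fst f {None}"
  show "fst g {None} = fst f {None}"
    using openin_Spec_F1(2)[OF K] Spec_map_F1(1)[OF H K h] by (simp add: g gs_comp_def compose_def)
  then have gx: "fst g {None} = x" by (simp add: x_def)
  note D = H.gs_homD[OF f x_def[symmetric]]
  have val: "stalk_val H X f b \<in> carrier (F1 H)" if "b \<in> carrier (stalk X x)" for b
    using H.local_mo_hom_stalk_val[OF f, folded x_def] that
    unfolding local_mo_hom_def mo_hom_def hom_def by blast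
  have map: "F1_map H h v \<in> carrier (F1 K)" if "v \<in> carrier (F1 H)" for v
    using F1_map_mo_hom[OF H K h] that unfolding mo_hom_def hom_def by blast
  have snd_g: "snd g V t = F1_section K (F1_map H h (stalk_val H X f (germ X x V t)))"
    if V: "openin (gtop X) V" "x \<in> V" "t \<in> carrier (gsec X V)" for V t
    using H.F1_section_stalk_val[OF f x_def[symmetric] V, symmetric]
      Spec_map_F1(2)[OF H K h val[OF H.X.germ_in_stalk[OF V]]] V
    by (simp add: g gs_comp_def H.preim_F1 x_def[symmetric])
  have sec: "snd g V t \<in> carrier (Spec_sec (F1 K) {{None}})"
    if V: "openin (gtop X) V" "x \<in> V" "t \<in> carrier (gsec X V)" for V t
    unfolding snd_g[OF V] K.H.carrier_Spec_sec_F1 using map val H.X.germ_in_stalk[OF V] by blast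
  have res: "snd g W (gres X V W t) = snd g V t"
    if V: "openin (gtop X) V" "openin (gtop X) W" "W \<subseteq> V" "x \<in> W" "t \<in> carrier (gsec X V)" for V W t
  proof -
    have "x \<in> V" using V by blast
    then show ?thesis
      using snd_g[OF V(1) _ V(5)] snd_g[OF V(2,4) H.X.res_closed[OF V(1,2,3,5)]] H.X.germ_res[OF V]
      by simp
  qed
  obtain V t where V: "openin (gtop X) V" "x \<in> V" "t \<in> carrier (gsec X V)" "a = germ X x V t"
    using a unfolding x_def[symmetric] by (rule H.X.stalkE)
  show "stalk_val K X g a = F1_map H h (stalk_val H X f a)"
    unfolding V(4)
    by (rule K.stalk_val_germ[OF gx sec res V(1-3) map[OF val[OF H.X.germ_in_stalk[OF V(1-3)]]] snd_g[OF V(1-3)]])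
qed


section \<open>Stalks of schemes\<close>

text \<open>If 1 = 0 in the stalk, then 1 = 0 in the sections over some neighbourhood W of x inside
  an affine chart. The inverse g of the chart carries this to the sections of Spec M over the
  preimage of W, and evaluation at the prime of x gives 1 = 0 in a localization at a prime. Working
  with sections avoids comparing the stalks of X with those of Spec M.\<close>

lemma stalk_one_neq_absorbing:
  assumes X: "geometric_scheme TYPE('u) X" and x: "x \<in> topspace (gtop X)"
  shows "\<one>\<^bsub>stalk X x\<^esub> \<noteq> absorbing (stalk X x)"
proof
  assume eq: "\<one>\<^bsub>stalk X x\<^esub> = absorbing (stalk X x)"
  interpret geometric_space X
    using X unfolding geometric_scheme_def by blast
  obtain U and M :: "'u monoid0" where U: "openin (gtop X) U" "x \<in> U" and M: "mo_monoid M"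
    and iso: "gs_isomorphic (open_subspace X U) (Spec M)"
    using X x unfolding geometric_scheme_def by blast
  obtain f g where f: "f \<in> gs_hom (open_subspace X U) (Spec M)"
    and g: "g \<in> gs_hom (Spec M) (open_subspace X U)"
    and gf: "gs_comp (open_subspace X U) (Spec M) (open_subspace X U) g f = gs_id (open_subspace X U)"
    using iso unfolding gs_isomorphic_def by blast
  have "(U, absorbing (gsec X U)) \<in> germ X x U \<one>\<^bsub>gsec X U\<^esub>"
    using germ_self[OF U sec_closed(2)[OF U(1)]] eq
    unfolding stalk_one_germ[OF U] stalk_absorbing_germ[OF U] by simp
  then obtain W where W: "openin (gtop X) W" "x \<in> W" "W \<subseteq> U"
      "gres X U W \<one>\<^bsub>gsec X U\<^esub> = gres X U W (absorbing (gsec X U))"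
    by (auto simp: germ_def)
  then have zero: "\<one>\<^bsub>gsec X W\<^esub> = absorbing (gsec X W)"
    using res_one[OF U(1) W(1,3)] res_absorbing[OF U(1) W(1,3)] by simp
  have top: "topspace (gtop (open_subspace X U)) = U"
    using openin_subset[OF U(1)] by (auto simp: open_subspace_def)
  have "W = W \<inter> U" using W(3) by blast
  then have "openin (gtop (open_subspace X U)) W"
    using W(1) by (auto simp: open_subspace_def openin_subtopology)
  then have "snd g W \<in> mo_hom (gsec X W) (Spec_sec M (preim (Spec M) g W))"
    using g unfolding gs_hom_def gsec_Spec by (auto simp: open_subspace_def)
  then have sec: "\<one>\<^bsub>Spec_sec M (preim (Spec M) g W)\<^esub> = absorbing (Spec_sec M (preim (Spec M) g W))"
    using zero unfolding mo_hom_def by auto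
  define \<pp> where "\<pp> = fst f x"
  have "\<pp> \<in> topspace (gtop (Spec M))"
    using f U(2) top unfolding gs_hom_def \<pp>_def continuous_map_def by auto
  then have prime: "mo_prime M \<pp>"
    using topspace_Spec_top[OF M] by (simp add: Spec_def)
  \<comment> \<open>g undoes f at x, which places the prime \<open>\<pp>\<close> in the preimage of
    W, where the sections can be evaluated.\<close>
  have "compose (topspace (gtop (open_subspace X U))) (fst g) (fst f) x = x"
    using gf U(2) unfolding gs_comp_def gs_id_def top by simp
  then have "fst g \<pp> = x"
    using U(2) unfolding top \<pp>_def by (simp add: compose_def)
  then have p: "\<pp> \<in> preim (Spec M) g W"
    using W(2) \<open>\<pp> \<in> topspace (gtop (Spec M))\<close> unfolding preim_def by blast
  have "\<one>\<^bsub>loc_at M \<pp>\<^esub> = absorbing (loc_at M \<pp>)"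
    using fun_cong[OF sec, of \<pp>] p by (simp add: Spec_sec_def)
  moreover interpret M: mo_monoid M by fact
  have "\<one>\<^bsub>loc_at M \<pp>\<^esub> \<noteq> absorbing (loc_at M \<pp>)"
    using prime unfolding mo_prime_def mo_ideal_def
    by (intro localization_one_neq_absorbing[OF M]) auto
  ultimately show False by blast
qed


section \<open>The disjoint union\<close>

lemma bij_betw_Sigma:
  assumes "\<And>x. x \<in> A \<Longrightarrow> bij_betw (g x) (B x) (C x)"
  shows "bij_betw (\<lambda>(x, y). (x, g x y)) (Sigma A B) (Sigma A C)"
proof (rule bij_betw_byWitness[where f' = "\<lambda>(x, z). (x, inv_into (B x) (g x) z)"])
  show "(\<lambda>(x, y). (x, g x y)) ` Sigma A B \<subseteq> Sigma A C"
    using assms bij_betw_apply by fastforce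
  show "(\<lambda>(x, z). (x, inv_into (B x) (g x) z)) ` Sigma A C \<subseteq> Sigma A B"
    using assms bij_betw_apply bij_betw_inv_into by fastforce
qed (auto simp: bij_betw_inv_into_left[OF assms] bij_betw_inv_into_right[OF assms])

lemma nat_iso_comp:
  assumes \<phi>: "nat_iso C F G \<phi>" and \<psi>: "nat_iso C G K \<psi>"
  shows "nat_iso C F K (\<lambda>A x. \<psi> A (\<phi> A x))"
proof -
  have "bij_betw (\<lambda>x. \<psi> A (\<phi> A x)) (fobj F A) (fobj K A)" if "A \<in> Ob C" for A
    using bij_betw_trans[of "\<phi> A" "fobj F A" "fobj G A" "\<psi> A" "fobj K A"] \<phi> \<psi> that
    unfolding nat_iso_def comp_def by blast
  moreover have \<phi>_closed: "\<phi> A x \<in> fobj G A" if "A \<in> Ob C" "x \<in> fobj F A" for A x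
    using \<phi> that unfolding nat_iso_def nat_trans_def by blast
  moreover have "\<psi> B (\<phi> B (fmap F A B f x)) = fmap K A B f (\<psi> A (\<phi> A x))"
    if o: "A \<in> Ob C" "B \<in> Ob C" "f \<in> Hom C A B" "x \<in> fobj F A" for A B f x
  proof -
    have "\<phi> B (fmap F A B f x) = fmap G A B f (\<phi> A x)"
      using \<phi> o unfolding nat_iso_def nat_trans_def by blast
    moreover have "\<psi> B (fmap G A B f (\<phi> A x)) = fmap K A B f (\<psi> A (\<phi> A x))"
      using \<psi> o \<phi>_closed[OF o(1,4)] unfolding nat_iso_def nat_trans_def by blast
    ultimately show ?thesis by simp
  qed
  ultimately show ?thesis
    using bij_betw_apply unfolding nat_iso_def nat_trans_def by fastforce
qed

text \<open>Whiskering with H \<mapsto> F1[H], which takes objects and morphisms of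
  \<open>Ab\<close> to those of \<open>Mo\<close>.\<close>

lemma nat_iso_restrict_F1:
  assumes "nat_iso Mo F G \<eta>"
  shows "nat_iso Ab (restrict_F1 F) (restrict_F1 G) (\<lambda>H. \<eta> (F1 H))"
proof -
  have ob: "F1 H \<in> Ob Mo" if "H \<in> Ob Ab" for H :: "'a monoid"
    using that mo_monoid_F1 by (simp add: Ab_def Mo_def)
  have hom: "F1_map H h \<in> Hom Mo (F1 H) (F1 K)"
    if "H \<in> Ob Ab" "K \<in> Ob Ab" "h \<in> Hom Ab H K" for H K :: "'a monoid" and h
    using that F1_map_mo_hom[of H K h] by (simp add: Ab_def Mo_def)
  have nat: "nat_trans Mo F G \<eta>" and bij: "\<And>A. A \<in> Ob Mo \<Longrightarrow> bij_betw (\<eta> A) (fobj F A) (fobj G A)"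
    using assms unfolding nat_iso_def by auto
  show ?thesis
    unfolding nat_iso_def nat_trans_def restrict_F1_def
    using nat[unfolded nat_trans_def] bij ob hom by simp
qed

text \<open>By locality the stalk value of a unit is never \<open>None\<close>, so
  \<open>the\<close> is applied only where it returns the group element.\<close>

definition disjoint_union_map ::
    "('p, 's) gspace \<Rightarrow> 'h monoid \<Rightarrow> ('h option set, 'h option set \<Rightarrow> ('h option \<times> 'h option) set, 'p, 's) gs_map
      \<Rightarrow> 'p \<times> (('p set \<times> 's) set \<Rightarrow> 'h)" where
  "disjoint_union_map X H f =
     (fst f {None}, \<lambda>u\<in>Units (stalk X (fst f {None})). the (stalk_val H X f u))"

text \<open>The second stage of the bijection is applied fibrewise over the points of X. Naturality
  keeps the index fixed because the induced map of spectra sends the one point to the one point; in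
  each fibre h then acts by composition.\<close>

lemma nat_iso_disjoint_union_map:
  fixes X :: "('p, 's) gspace"
  assumes X: "geometric_scheme TYPE('h option) X"
  shows "nat_iso Ab (restrict_F1 (hom_Spec X))
    (disjoint_union (topspace (gtop X)) (\<lambda>x. ab_hom_functor (units_of (stalk X x) :: ('p set \<times> 's) set monoid)))
    (disjoint_union_map X :: 'h monoid \<Rightarrow> _)"
proof -
  let ?D = "disjoint_union (topspace (gtop X)) (\<lambda>x. ab_hom_functor (units_of (stalk X x)))
    :: ('h, 'p \<times> (('p set \<times> 's) set \<Rightarrow> 'h)) ab_fun"
  have gs: "geometric_space X"
    using X unfolding geometric_scheme_def by blast
  have bij: "bij_betw (disjoint_union_map X H) (gs_hom (Spec (F1 H)) X) (fobj ?D H)"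
    if H: "comm_group H" for H
  proof -
    interpret F1_points X H
      using gs H by (simp add: F1_points_def coefficient_group_def)
    have "bij_betw (\<lambda>(x, \<sigma>). (x, \<lambda>u\<in>Units (stalk X x). the (\<sigma> u)))
        (SIGMA x:topspace (gtop X). {\<sigma>. local_mo_hom (stalk X x) (F1 H) \<sigma>})
        (SIGMA x:topspace (gtop X). ab_hom (units_of (stalk X x)) H)"
      by (intro bij_betw_Sigma bij_betw_local_mo_hom_F1 X.mo_monoid_stalk H stalk_one_neq_absorbing[OF X])
    from bij_betw_trans[OF bij_betw_gs_hom_local_mo_hom this] show ?thesis
      by (simp add: comp_def disjoint_union_map_def[abs_def] disjoint_union_def ab_hom_functor_def)
  qed
  have nat: "disjoint_union_map X K (gs_comp (Spec (F1 K)) (Spec (F1 H)) X f (Spec_map (F1 H) (F1 K) (F1_map H h)))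
      = fmap ?D H K h (disjoint_union_map X H f)"
    if H: "comm_group H" and K: "comm_group K" and h: "h \<in> ab_hom H K"
      and f: "f \<in> gs_hom (Spec (F1 H)) X" for H K h f
  proof -
    interpret F1_points X H
      using gs H by (simp add: F1_points_def coefficient_group_def)
    define g where "g = gs_comp (Spec (F1 K)) (Spec (F1 H)) X f (Spec_map (F1 H) (F1 K) (F1_map H h))"
    define x where "x = fst f {None}"
    interpret S: mo_monoid "stalk X x"
      using X.mo_monoid_stalk gs_homD(1)[OF f x_def[symmetric]] .
    note comp = stalk_val_gs_comp[OF gs H K h f g_def, folded x_def]
    have "the (stalk_val K X g u) = h (the (stalk_val H X f u))" if u: "u \<in> Units (stalk X x)" for u
    proof -
      \<comment> \<open>On an element \<open>Some v\<close>, \<open>F1_map\<close> applies h under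
        \<open>Some\<close>, so \<open>the\<close> commutes with h.\<close>
      have "stalk_val H X f u \<in> Units (F1 H)"
        using local_mo_hom_stalk_val[OF f, folded x_def] u unfolding local_mo_hom_def by blast
      then obtain v where "stalk_val H X f u = Some v" "v \<in> carrier H"
        unfolding Units_F1[OF H] by blast
      then show ?thesis
        using comp(1)[OF S.Units_closed[OF u]] by (simp add: F1_map_def F1_def)
    qed
    then show ?thesis
      using comp(2)[OF S.one_closed] unfolding g_def[symmetric]
      by (simp add: disjoint_union_map_def disjoint_union_def ab_hom_functor_def units_of_def
          compose_def x_def[symmetric] restrict_def fun_eq_iff)
  qed
  show ?thesis
    unfolding nat_iso_def nat_trans_def
    using bij nat bij_betw_apply[OF bij]
    by (simp add: restrict_F1_def hom_Spec_def Ab_def)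
qed

theorem proposition3p18:
  fixes F :: "('h option, 'x) mo_fun"
    and X :: "('p, 's) gspace"
    and \<eta> :: "'h option monoid0 \<Rightarrow> 'x
      \<Rightarrow> ('h option set, 'h option set \<Rightarrow> ('h option \<times> 'h option) set, 'p, 's) gs_map"
  assumes "mo_scheme F"
    and "geometric_realization F X \<eta>"
  shows "nat_iso Ab (restrict_F1 F) (restrict_F1 (hom_Spec X)) (\<lambda>H. \<eta> (F1 H)) \<and>
    (\<exists>\<theta>. nat_iso Ab (restrict_F1 (hom_Spec X))
           (disjoint_union (topspace (gtop X)) (\<lambda>x. ab_hom_functor (units_of (stalk X x)))) \<theta> \<and>
         nat_iso Ab (restrict_F1 F)
           (disjoint_union (topspace (gtop X)) (\<lambda>x. ab_hom_functor (units_of (stalk X x))))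
           (\<lambda>H a. \<theta> H (\<eta> (F1 H) a)) \<and>
         (\<forall>H \<in> Ob Ab. \<forall>\<phi> \<in> gs_hom (Spec (F1 H)) X. fst (\<theta> H \<phi>) = fst \<phi> {None}))"
proof -
  have X: "geometric_scheme TYPE('h option) X" and "nat_iso Mo F (hom_Spec X) \<eta>"
    using assms(2) unfolding geometric_realization_def by auto
  then have \<eta>: "nat_iso Ab (restrict_F1 F) (restrict_F1 (hom_Spec X)) (\<lambda>H. \<eta> (F1 H))"
    by (intro nat_iso_restrict_F1)
  \<comment> \<open>One witness serves all clauses on \<open>\<theta>\<close>; the clause on the
    index is the first component of \<open>disjoint_union_map\<close>.\<close>
  show ?thesis
    using \<eta> nat_iso_disjoint_union_map[OF X] nat_iso_comp[OF \<eta> nat_iso_disjoint_union_map[OF X]]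
    by (intro conjI exI[of _ "disjoint_union_map X"]) (simp_all add: disjoint_union_map_def)
qed

end
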